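(* Let $f_1,\dots,f_n:\mathbb{R}^d\to\mathbb{R}$ be convex, with each $f_i$ $L_i$-smooth ($L_i>0$), let $g:\mathbb{R}^d\to\mathbb{R}$ be convex (not necessarily strongly convex, possibly non-smooth), let $F=\frac1n\sum_{i=1}^n f_i+g$ and let $x^\star$ be a minimizer of $F$. By applying the adaptive regularization technique (described in the context) to ASVRG for strongly convex objectives, with suitable parameters, one obtains from the starting point $\widetilde x^0$ an $\varepsilon$-suboptimal solution, i.e. a (random) point $\widehat x$ with $\mathbb{E}[F(\widehat x)]-F(x^\star)\le\varepsilon$, using at most the following oracle complexity: $$\mathcal{O}\left(n\log\frac{F(\widetilde x^0)-F(x^\star)}{\varepsilon}+\frac{\sqrt{n\widetilde L}\,\|\widetilde x^0-x^\star\|}{\sqrt{\varepsilon}}\right).$$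
   Context: $L_i$-smooth means differentiable with $\|\nabla f_i(x)-\nabla f_i(y)\|\le L_i\|x-y\|$ for all $x,y$. $P=(p_1,\dots,p_n)$ is a probability vector with all $p_i>0$, $f=\frac1n\sum_i f_i$, $\widetilde L:=\max_j L_j/(np_j)$. Oracle complexity is the total number of component gradient evaluations $\nabla f_i(\cdot)$. $\mathcal O$ hides only an absolute constant, and, as usual, $\varepsilon$ is small compared to the initial gap, e.g. $0<\varepsilon\le\frac12(F(\widetilde x^0)-F(x^\star))$. Adaptive regularization (Allen-Zhu and Hazan): given $\sigma_0>0$ and a number of rounds $T$, set $\widehat x_0=\widetilde x^0$; for $t=0,\dots,T-1$, apply the base algorithm, started at $\widehat x_t$, to the strongly convex objective $F(x)+\frac{\sigma_t}{2}\|x-\widetilde x^0\|^2$ (the smooth part is $f$, the regularizer is the $\sigma_t$-strongly convex function $g(x)+\frac{\sigma_t}{2}\|x-\widetilde x^0\|^2$), running it until the expected objective gap of this regularized problem is reduced to at most $1/4$ of its initial value; call the result $\widehat x_{t+1}$ and put $\sigma_{t+1}=\sigma_t/2$. The output is $\widehat x_T$. The parameters $\sigma_0$ and $T$ may depend on $F(\widetilde x^0)-F(x^\star)$, $\|\widetilde x^0-x^\star\|$ and $\varepsilon$. Base algorithm: ASVRG for a strongly convex objective $f+h$ ($h$ being $\mu$-strongly convex) with Option II and restarts, with step size $\eta$, momentum parameter $\omega$, $0<\omega\le1-\frac{\widetilde L\eta}{1-\widetilde L\eta}$, $0<\eta<1/\widetilde L$, epoch length $m$, started at $z^0$: set $x_0^1=y_0^1=z^0$.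 For $s=1,2,\dots$: compute $\nabla f(z^{s-1})$; for $t=1,\dots,m$, draw $i_t$ according to $P$ independently and set $\widetilde\nabla_t=\frac{\nabla f_{i_t}(x^s_{t-1})-\nabla f_{i_t}(z^{s-1})}{np_{i_t}}+\nabla f(z^{s-1})$, $y_t^s=\arg\min_y\{\langle\widetilde\nabla_t,y-y^s_{t-1}\rangle+\frac{\omega}{2\eta}\|y-y^s_{t-1}\|^2+h(y)\}$, $x_t^s=z^{s-1}+\omega(y_t^s-z^{s-1})$; then $z^s=\frac1m\sum_{t=1}^m x_t^s$, $y_0^{s+1}=y_m^s$, $x_0^{s+1}=(1-\omega)z^s+\omega y_m^s$. After every $\mathcal S=2\left(\frac{1-\omega}{\omega}+\frac{\omega}{\eta m\mu}\right)$ epochs (rounded up) the procedure is restarted from the initial point $\frac1{\mathcal S}\sum_{s=1}^{\mathcal S}z^s$. *)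

theory Defs
  imports "HOL-Probability.Probability"
begin

text \<open>
  The complexity bound has one absolute constant that serves all dimensions \<open>d\<close>, so \<open>d\<close> has to be
  quantified inside the statement. Therefore the space of \<open>d\<close>-dimensional real vectors is not a
  type but the set \<open>Rd d\<close> of vectors supported on the first \<open>d\<close> coordinates, inside the inner
  product space \<open>rvec\<close> of finitely supported real sequences. The type \<open>nat \<Rightarrow>\<^sub>0 real\<close> is not used
  because its library norm is not the Euclidean one.
\<close>

typedef rvec = "{x :: nat \<Rightarrow> real. finite {i. x i \<noteq> 0}}"
  morphisms coord Abs_rvec
  by (rule exI[of _ "\<lambda>_. 0"]) simp

setup_lifting type_definition_rvec

instantiation rvec :: real_vector
begin

lift_definition zero_rvec :: rvec is "\<lambda>_. 0" by simp

lift_definition plus_rvec :: "rvec \<Rightarrow> rvec \<Rightarrow> rvec" is "\<lambda>x y i. x i + y i"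
  subgoal for x y by (rule finite_subset[of _ "{i. x i \<noteq> 0} \<union> {i. y i \<noteq> 0}"]) auto
  done

lift_definition minus_rvec :: "rvec \<Rightarrow> rvec \<Rightarrow> rvec" is "\<lambda>x y i. x i - y i"
  subgoal for x y by (rule finite_subset[of _ "{i. x i \<noteq> 0} \<union> {i. y i \<noteq> 0}"]) auto
  done

lift_definition uminus_rvec :: "rvec \<Rightarrow> rvec" is "\<lambda>x i. - x i" by simp

lift_definition scaleR_rvec :: "real \<Rightarrow> rvec \<Rightarrow> rvec" is "\<lambda>c x i. c * x i"
  by (rule finite_subset[rotated]) auto

instance
  by (intro_classes; transfer; simp add: fun_eq_iff algebra_simps)

end

instantiation rvec :: real_inner
begin

lift_definition inner_rvec :: "rvec \<Rightarrow> rvec \<Rightarrow> real" is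
  "\<lambda>x y. \<Sum>i | x i \<noteq> 0. x i * y i" .

definition norm_rvec :: "rvec \<Rightarrow> real" where "norm (x :: rvec) = sqrt (x \<bullet> x)"

definition sgn_rvec :: "rvec \<Rightarrow> rvec" where "sgn (x :: rvec) = x /\<^sub>R norm x"

definition dist_rvec :: "rvec \<Rightarrow> rvec \<Rightarrow> real" where "dist (x :: rvec) y = norm (x - y)"

definition uniformity_rvec :: "(rvec \<times> rvec) filter" where
  "(uniformity :: (rvec \<times> rvec) filter) = (INF e\<in>{0 <..}. principal {(x, y). dist (x :: rvec) y < e})"

definition open_rvec :: "rvec set \<Rightarrow> bool" where
  "open (U :: rvec set) = (\<forall>x\<in>U. eventually (\<lambda>(x', y :: rvec). x' = x \<longrightarrow> y \<in> U) uniformity)"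

lemma inner_rvec_eq_sum:
  assumes "finite A" "{i. coord x i \<noteq> 0} \<subseteq> A"
  shows "x \<bullet> y = (\<Sum>i\<in>A. coord x i * coord y i)"
  unfolding inner_rvec.rep_eq using assms by (intro sum.mono_neutral_left) auto

instance
proof
  fix x y z :: rvec and a :: real
  show "dist x y = norm (x - y)" "sgn x = x /\<^sub>R norm x" "norm x = sqrt (x \<bullet> x)"
    "uniformity = (INF e\<in>{0 <..}. principal {(x :: rvec, y). dist x y < e})"
    by (fact dist_rvec_def sgn_rvec_def norm_rvec_def uniformity_rvec_def)+
  show "open U = (\<forall>x\<in>U. eventually (\<lambda>(x', y). x' = x \<longrightarrow> y \<in> U) uniformity)" for U :: "rvec set"
    by (fact open_rvec_def)
  define A where "A = {i. coord x i \<noteq> 0} \<union> {i. coord y i \<noteq> 0} \<union> {i. coord z i \<noteq> 0}"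
  have A: "finite A" using coord[of x] coord[of y] coord[of z] by (simp add: A_def)
  note eqs = plus_rvec.rep_eq scaleR_rvec.rep_eq
  have *: "u \<bullet> v = (\<Sum>i\<in>A. coord u i * coord v i)" if "u \<in> {x, y, z, x + y, a *\<^sub>R x}" for u v
    using that by (intro inner_rvec_eq_sum[OF A]) (auto simp: A_def eqs)
  show "x \<bullet> y = y \<bullet> x" by (simp add: * mult.commute)
  show "(x + y) \<bullet> z = x \<bullet> z + y \<bullet> z" by (simp add: * eqs distrib_right sum.distrib)
  show "a *\<^sub>R x \<bullet> y = a * (x \<bullet> y)" by (simp add: * eqs sum_distrib_left mult.assoc)
  show "0 \<le> x \<bullet> x" by (simp add: * sum_nonneg)
  have "x \<bullet> x = 0 \<longleftrightarrow> (\<forall>i\<in>A. coord x i = 0)"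
    by (simp add: * A sum_nonneg_eq_0_iff)
  also have "\<dots> \<longleftrightarrow> (\<forall>i. coord x i = 0)" by (auto simp: A_def)
  also have "\<dots> \<longleftrightarrow> x = 0" by transfer (simp add: fun_eq_iff)
  finally show "x \<bullet> x = 0 \<longleftrightarrow> x = 0" .
qed

end

definition Rd :: "nat \<Rightarrow> rvec set" where
  "Rd d = {x. \<forall>i\<ge>d. coord x i = 0}"

definition smooth_on_Rd :: "nat \<Rightarrow> real \<Rightarrow> (rvec \<Rightarrow> real) \<Rightarrow> (rvec \<Rightarrow> rvec) \<Rightarrow> bool" where
  "smooth_on_Rd d L \<phi> G \<longleftrightarrow>
     (\<forall>x\<in>Rd d. G x \<in> Rd d \<and> (\<phi> has_derivative (\<lambda>v. G x \<bullet> v)) (at x within Rd d)) \<and>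
     (\<forall>x\<in>Rd d. \<forall>y\<in>Rd d. norm (G x - G y) \<le> L * norm (x - y))"

text \<open>
  Data of a composite finite-sum problem: the components are \<open>component Q i\<close> for \<open>i < size_n Q\<close>, with
  gradients \<open>grad Q i\<close> and smoothness constants \<open>lip Q i\<close>; \<open>reg Q\<close> is the (possibly non-smooth)
  regularizer and \<open>samp Q\<close> the distribution \<open>P\<close> of the sampled index.
\<close>

record finite_sum =
  vdim :: nat
  size_n :: nat
  component :: "nat \<Rightarrow> rvec \<Rightarrow> real"
  grad :: "nat \<Rightarrow> rvec \<Rightarrow> rvec"
  lip :: "nat \<Rightarrow> real"
  reg :: "rvec \<Rightarrow> real"
  samp :: "nat pmf"

definition finite_sum_problem :: "finite_sum \<Rightarrow> bool" where
  "finite_sum_problem Q \<longleftrightarrow>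
     set_pmf (samp Q) = {..<size_n Q} \<and>
     (\<forall>i<size_n Q. lip Q i > 0 \<and> convex_on (Rd (vdim Q)) (component Q i) \<and>
        smooth_on_Rd (vdim Q) (lip Q i) (component Q i) (grad Q i)) \<and>
     convex_on (Rd (vdim Q)) (reg Q)"

definition objective :: "finite_sum \<Rightarrow> rvec \<Rightarrow> real" where
  "objective Q x = (\<Sum>i<size_n Q. component Q i x) / real (size_n Q) + reg Q x"

definition Ltilde :: "finite_sum \<Rightarrow> real" where
  "Ltilde Q = Max ((\<lambda>j. lip Q j / (real (size_n Q) * pmf (samp Q) j)) ` {..<size_n Q})"

definition full_grad :: "finite_sum \<Rightarrow> rvec \<Rightarrow> rvec" where
  "full_grad Q x = (\<Sum>i<size_n Q. grad Q i x) /\<^sub>R real (size_n Q)"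

record asvrg_params =
  stepsize :: real
  momentum :: real
  epoch_len :: nat

definition admissible_params :: "finite_sum \<Rightarrow> asvrg_params \<Rightarrow> bool" where
  "admissible_params Q A \<longleftrightarrow>
     0 < stepsize A \<and> stepsize A < 1 / Ltilde Q \<and>
     0 < momentum A \<and>
     momentum A \<le> 1 - Ltilde Q * stepsize A / (1 - Ltilde Q * stepsize A) \<and>
     1 \<le> epoch_len A"

text \<open>\<open>k\<close> successive transitions of a Markov kernel \<open>K\<close> started at \<open>s\<close>.\<close>

definition iterate_pmf :: "nat \<Rightarrow> ('s \<Rightarrow> 's pmf) \<Rightarrow> 's \<Rightarrow> 's pmf" where
  "iterate_pmf k K s = ((\<lambda>M. bind_pmf M K) ^^ k) (return_pmf s)"

text \<open>
  All algorithms below carry a counter \<open>c\<close> of the component gradient evaluations made so far: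
  \<open>size_n Q\<close> for each full gradient at a snapshot and two for each variance-reduced estimator.

  State of the inner loop with snapshot \<open>z\<close>: the current \<open>x\<close> and \<open>y\<close>, the sum \<open>a\<close> of the
  \<open>x\<close>-iterates produced so far in this epoch, and \<open>c\<close>.
\<close>

definition asvrg_step ::
  "finite_sum \<Rightarrow> asvrg_params \<Rightarrow> rvec \<Rightarrow> rvec \<times> rvec \<times> rvec \<times> nat \<Rightarrow> (rvec \<times> rvec \<times> rvec \<times> nat) pmf"
where
  "asvrg_step Q A z = (\<lambda>(x, y, a, c). map_pmf (\<lambda>i.
     let v = (grad Q i x - grad Q i z) /\<^sub>R (real (size_n Q) * pmf (samp Q) i) + full_grad Q z;
         y' = arg_min_on (\<lambda>u. v \<bullet> (u - y)
                + momentum A / (2 * stepsize A) * (norm (u - y))\<^sup>2 + reg Q u) (Rd (vdim Q));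
         x' = z + momentum A *\<^sub>R (y' - z)
     in (x', y', a + x', c + 2)) (samp Q))"

text \<open>
  State between epochs: the snapshot \<open>z\<close>, the starting points \<open>x\<close> and \<open>y\<close> of the next epoch, the sum
  \<open>Z\<close> of the snapshots produced since the last restart, and \<open>c\<close>.
\<close>

definition asvrg_epoch ::
  "finite_sum \<Rightarrow> asvrg_params \<Rightarrow> rvec \<times> rvec \<times> rvec \<times> rvec \<times> nat
    \<Rightarrow> (rvec \<times> rvec \<times> rvec \<times> rvec \<times> nat) pmf"
where
  "asvrg_epoch Q A = (\<lambda>(z, x, y, Z, c).
     map_pmf (\<lambda>(x', y', a, c').
       let z' = a /\<^sub>R real (epoch_len A)
       in (z', (1 - momentum A) *\<^sub>R z' + momentum A *\<^sub>R y', y', Z + z', c'))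
     (iterate_pmf (epoch_len A) (asvrg_step Q A z) (x, y, 0, c + size_n Q)))"

definition restart_len :: "real \<Rightarrow> asvrg_params \<Rightarrow> nat" where
  "restart_len \<mu> A = nat \<lceil>2 * ((1 - momentum A) / momentum A
     + momentum A / (stepsize A * real (epoch_len A) * \<mu>))\<rceil>"

text \<open>
  The epochs between two restarts. The state consists of the point from which the procedure is
  (re)started and \<open>c\<close>; \<open>\<mu>\<close> is the strong convexity parameter of \<open>reg Q\<close>.
\<close>

definition asvrg_block ::
  "finite_sum \<Rightarrow> real \<Rightarrow> asvrg_params \<Rightarrow> rvec \<times> nat \<Rightarrow> (rvec \<times> nat) pmf" where
  "asvrg_block Q \<mu> A = (\<lambda>(z, c).
     map_pmf (\<lambda>(_, _, _, Z, c'). (Z /\<^sub>R real (restart_len \<mu> A), c'))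
     (iterate_pmf (restart_len \<mu> A) (asvrg_epoch Q A) (z, z, z, 0, c)))"

definition asvrg :: "finite_sum \<Rightarrow> real \<Rightarrow> asvrg_params \<Rightarrow> nat \<Rightarrow> rvec \<times> nat \<Rightarrow> (rvec \<times> nat) pmf" where
  "asvrg Q \<mu> A k = iterate_pmf k (asvrg_block Q \<mu> A)"

definition gap :: "finite_sum \<Rightarrow> rvec \<Rightarrow> real" where
  "gap Q x = objective Q x - (INF u\<in>Rd (vdim Q). objective Q u)"

definition quartered :: "finite_sum \<Rightarrow> real \<Rightarrow> asvrg_params \<Rightarrow> rvec \<Rightarrow> nat \<Rightarrow> bool" where
  "quartered Q \<mu> A z k \<longleftrightarrow>
     measure_pmf.expectation (asvrg Q \<mu> A k (z, 0)) (\<lambda>(x, _). gap Q x) \<le> gap Q z / 4"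

text \<open>
  One call of the base algorithm, stopped at the first restart at which the expected gap is at most
  a quarter of its value at the starting point of the call. The \<open>LEAST\<close> is meaningful only
  if there is such a restart.
\<close>

definition asvrg_until_quartered ::
  "finite_sum \<Rightarrow> real \<Rightarrow> asvrg_params \<Rightarrow> rvec \<times> nat \<Rightarrow> (rvec \<times> nat) pmf" where
  "asvrg_until_quartered Q \<mu> A = (\<lambda>(z, c). asvrg Q \<mu> A (LEAST k. quartered Q \<mu> A z k) (z, c))"

definition regularize :: "finite_sum \<Rightarrow> rvec \<Rightarrow> real \<Rightarrow> finite_sum" where
  "regularize Q x0 \<sigma> = Q\<lparr>reg := \<lambda>x. reg Q x + \<sigma> / 2 * (norm (x - x0))\<^sup>2\<rparr>"

text \<open>
  Joint distribution of the point reached after the given number of rounds and the gradient count;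
  round \<open>t\<close> uses \<open>\<sigma>\<^sub>t = \<sigma>0 / 2 ^ t\<close> and the parameters \<open>A t\<close>.
\<close>

primrec adapt_reg_asvrg ::
  "finite_sum \<Rightarrow> rvec \<Rightarrow> real \<Rightarrow> (nat \<Rightarrow> asvrg_params) \<Rightarrow> nat \<Rightarrow> (rvec \<times> nat) pmf" where
  "adapt_reg_asvrg Q x0 \<sigma>0 A 0 = return_pmf (x0, 0)"
| "adapt_reg_asvrg Q x0 \<sigma>0 A (Suc t) =
     bind_pmf (adapt_reg_asvrg Q x0 \<sigma>0 A t)
       (asvrg_until_quartered (regularize Q x0 (\<sigma>0 / 2 ^ t)) (\<sigma>0 / 2 ^ t) (A t))"

end

theory Submission
  imports Defs
begin

text \<open>
  Let \<open>\<omega>\<close>, \<open>\<eta>\<close>, \<open>m\<close> be the momentum, step size and epoch length, \<open>z\<close> the current snapshot and \<open>u\<close> any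
  comparison point. Smoothness, the variance bound \<open>2 L (f z - f x - \<nabla>f x \<bullet> (z - x))\<close> of the estimator
  (by co-coercivity) and the three-point inequality of the proximal step give, since
  \<open>L \<eta> / (1 - L \<eta>) \<le> 1 - \<omega>\<close>, that the conditional expectation of
  \<open>F x\<^sub>t + \<omega>\<^sup>2 / (2 \<eta>) |u - y\<^sub>t|\<^sup>2\<close> is at most
  \<open>(1 - \<omega>) F z + \<omega> F u + \<omega>\<^sup>2 / (2 \<eta>) |u - y\<^bsub>t-1\<^esub>|\<^sup>2\<close>. This telescopes over the steps of an
  epoch and again over epochs; with \<open>u\<close> the minimizer, \<open>\<mu>\<close>-strong convexity and the restart length,
  every restart halves the expected gap, so each round needs at most two restarts.

  With \<open>\<eta> = 1 / (4 L)\<close>, \<open>m = n\<close> and \<open>\<omega> = min (1/2) (sqrt (n \<mu> / L))\<close> a round costs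
  \<open>O(n + sqrt (n L / \<mu>))\<close>. Let \<open>\<Delta>\<close> and \<open>R\<close> be the initial gap and the distance of the starting point to \<open>xstar\<close>.
  Passing from \<open>\<sigma>\<^sub>t\<close> to \<open>\<sigma>\<^bsub>t+1\<^esub> = \<sigma>\<^sub>t / 2\<close> increases the gap of the regularized problem by at most
  \<open>\<sigma>\<^bsub>t+1\<^esub> R\<^sup>2 / 2\<close>, so after \<open>T\<close> rounds it is at most \<open>\<Delta> / 4\<^sup>T + \<sigma>\<^sub>T R\<^sup>2\<close>. The choice
  \<open>\<sigma>\<^sub>0 = \<Delta> / R\<^sup>2\<close>, \<open>2\<^sup>T \<approx> 4 \<Delta> / \<epsilon>\<close> makes this \<open>O(\<epsilon>)\<close>, and the costs of the rounds form a constant part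
  times \<open>T\<close> plus a geometric series dominated by its last term.
\<close>

section \<open>Strongly convex minimization on \<open>Rd d\<close>\<close>

lemma norm_convex_combination_sq:
  fixes u w y :: "'a::real_inner"
  shows "(norm ((1 - t) *\<^sub>R u + t *\<^sub>R w - y))\<^sup>2
    = (1 - t) * (norm (u - y))\<^sup>2 + t * (norm (w - y))\<^sup>2 - t * (1 - t) * (norm (w - u))\<^sup>2"
  unfolding power2_norm_eq_inner
  by (simp add: inner_diff inner_add inner_commute) (simp add: algebra_simps)

lemma convex_plus_quadratic_combination:
  fixes \<phi> :: "'a::real_inner \<Rightarrow> real"
  assumes "convex_on S \<phi>" "u \<in> S" "w \<in> S" "0 \<le> t" "t \<le> 1"
  shows "\<phi> ((1 - t) *\<^sub>R u + t *\<^sub>R w) + c / 2 * (norm ((1 - t) *\<^sub>R u + t *\<^sub>R w - y))\<^sup>2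
    \<le> (1 - t) * (\<phi> u + c / 2 * (norm (u - y))\<^sup>2) + t * (\<phi> w + c / 2 * (norm (w - y))\<^sup>2)
      - c / 2 * t * (1 - t) * (norm (w - u))\<^sup>2"
proof -
  have "\<phi> ((1 - t) *\<^sub>R u + t *\<^sub>R w) \<le> (1 - t) * \<phi> u + t * \<phi> w"
    using assms by (intro convex_onD)
  moreover have "c / 2 * ((1 - t) * a + t * b - t * (1 - t) * e)
      = (1 - t) * (c / 2 * a) + t * (c / 2 * b) - c / 2 * t * (1 - t) * e" for a b e
    by (simp add: field_simps)
  ultimately show ?thesis
    unfolding norm_convex_combination_sq by (simp only: distrib_left)
qed

text \<open>Minimality of \<open>u\<close> against the point with parameter \<open>t\<close> on the
  segment to \<open>w\<close>, combined with strong convexity there, gives the claim with the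
  quadratic term damped by \<open>s = 1 - t\<close>; letting \<open>s\<close> tend to 1 restores the
  full modulus. This inequality later supplies both the three-point inequality of the proximal step
  and the growth of a regularized objective at its minimizer.\<close>

lemma quadratic_growth_at_minimum:
  fixes \<phi> :: "'a::real_inner \<Rightarrow> real"
  assumes cvx: "convex_on S \<phi>" and u: "u \<in> S" and w: "w \<in> S"
    and min: "\<And>v. v \<in> S \<Longrightarrow> \<phi> u + c / 2 * (norm (u - y))\<^sup>2 \<le> \<phi> v + c / 2 * (norm (v - y))\<^sup>2"
  shows "\<phi> u + c / 2 * (norm (u - y))\<^sup>2 + c / 2 * (norm (w - u))\<^sup>2 \<le> \<phi> w + c / 2 * (norm (w - y))\<^sup>2"
proof -
  let ?\<psi> = "\<lambda>v. \<phi> v + c / 2 * (norm (v - y))\<^sup>2"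
  have "s * (c / 2 * (norm (w - u))\<^sup>2) \<le> ?\<psi> w - ?\<psi> u" if s: "0 < s" "s < 1" for s
  proof -
    define t where "t = 1 - s"
    have t: "0 < t" "t < 1" using s by (auto simp: t_def)
    have "convex S" using cvx by (simp add: convex_on_def)
    then have "(1 - t) *\<^sub>R u + t *\<^sub>R w \<in> S"
      using convexD[OF _ u w, of "1 - t" t] t by simp
    from min[OF this] convex_plus_quadratic_combination[OF cvx u w, of t c y] t
    have "?\<psi> u \<le> (1 - t) * ?\<psi> u + t * ?\<psi> w - c / 2 * t * (1 - t) * (norm (w - u))\<^sup>2" by linarith
    also have "\<dots> = ?\<psi> u + t * (?\<psi> w - ?\<psi> u) - t * (s * (c / 2 * (norm (w - u))\<^sup>2))"
      by (simp add: t_def field_simps)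
    finally have "t * (s * (c / 2 * (norm (w - u))\<^sup>2)) \<le> t * (?\<psi> w - ?\<psi> u)" by simp
    then show ?thesis using t(1) by simp
  qed
  then have "c / 2 * (norm (w - u))\<^sup>2 \<le> ?\<psi> w - ?\<psi> u"
    by (rule field_le_mult_one_interval)
  then show ?thesis by simp
qed

text \<open>Strong convexity makes every minimizing sequence Cauchy, so completeness of
  \<open>S\<close> takes the place of compactness.\<close>

lemma convex_plus_quadratic_attains_min:
  fixes \<phi> :: "'a::real_inner \<Rightarrow> real"
  assumes cvx: "convex_on S \<phi>" and S: "Topological_Spaces.complete S" "S \<noteq> {}"
    and cont: "continuous_on S \<phi>" and c: "0 < c"
    and bdd: "\<And>v. v \<in> S \<Longrightarrow> b \<le> \<phi> v + c / 2 * (norm (v - y))\<^sup>2"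
  shows "\<exists>u\<in>S. \<forall>v\<in>S. \<phi> u + c / 2 * (norm (u - y))\<^sup>2 \<le> \<phi> v + c / 2 * (norm (v - y))\<^sup>2"
proof -
  define \<psi> where "\<psi> v = \<phi> v + c / 2 * (norm (v - y))\<^sup>2" for v
  define I where "I = (INF v\<in>S. \<psi> v)"
  have bb: "bdd_below (\<psi> ` S)" using bdd by (auto simp: \<psi>_def bdd_below_def)
  have I: "I \<le> \<psi> v" if "v \<in> S" for v
    unfolding I_def using bb that by (rule cINF_lower)
  have "\<exists>v\<in>S. \<psi> v < I + e" if "0 < e" for e
  proof -
    have "\<exists>x\<in>\<psi> ` S. x < I + e"
      by (rule cInf_lessD) (use S that in \<open>auto simp: I_def\<close>)
    then show ?thesis by auto
  qed
  then have "\<exists>v\<in>S. \<psi> v < I + 1 / real (Suc n)" for n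
    by simp
  then obtain X where X: "\<And>n. X n \<in> S" "\<And>n. \<psi> (X n) < I + 1 / real (Suc n)" by metis
  \<comment> \<open>The midpoint of two iterates still has value at least \<open>I\<close>; with
    \<open>t = 1/2\<close> the strong convexity term has coefficient
    \<open>c / 2 * (1 / 4) = c / 8\<close>.\<close>
  have dist: "c / 8 * (norm (X m - X n))\<^sup>2 < 1 / real (Suc N)" if "N \<le> m" "N \<le> n" for m n N
  proof -
    have "convex S" using cvx by (simp add: convex_on_def)
    then have "(1 - 1/2) *\<^sub>R X n + (1/2) *\<^sub>R X m \<in> S"
      using convexD[OF _ X(1)[of n] X(1)[of m], of "1/2" "1/2"] by simp
    from I[OF this] convex_plus_quadratic_combination[OF cvx X(1)[of n] X(1)[of m], of "1/2" c y]
    have "I \<le> 1/2 * \<psi> (X n) + 1/2 * \<psi> (X m) - c / 8 * (norm (X m - X n))\<^sup>2"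
      by (simp add: \<psi>_def)
    moreover have "1 / real (Suc n) \<le> 1 / real (Suc N)" "1 / real (Suc m) \<le> 1 / real (Suc N)"
      using that by (auto simp: frac_le)
    ultimately show ?thesis using X(2)[of n] X(2)[of m] by linarith
  qed
  have "Cauchy X"
  proof (rule metric_CauchyI)
    fix e :: real assume e: "0 < e"
    obtain N where N: "1 / real (Suc N) < c / 8 * e\<^sup>2"
      using nat_approx_posE[of "c / 8 * e\<^sup>2"] e c by auto
    have "dist (X m) (X n) < e" if "m \<ge> N" "n \<ge> N" for m n
    proof -
      have "c / 8 * (norm (X m - X n))\<^sup>2 < c / 8 * e\<^sup>2" using dist[OF that] N by simp
      then have "(norm (X m - X n))\<^sup>2 < e\<^sup>2" using c by simp
      then show ?thesis using e by (simp add: dist_norm power2_less_imp_less)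
    qed
    then show "\<exists>M. \<forall>m\<ge>M. \<forall>n\<ge>M. dist (X m) (X n) < e" by blast
  qed
  then obtain l where l: "l \<in> S" "X \<longlonglongrightarrow> l"
    using S(1) X(1) unfolding Real_Vector_Spaces.complete_def by blast
  have "continuous_on S \<psi>" unfolding \<psi>_def by (intro continuous_intros cont)
  then have "(\<lambda>n. \<psi> (X n)) \<longlonglongrightarrow> \<psi> l"
    using X(1) l by (simp add: continuous_on_tendsto_compose)
  moreover have "(\<lambda>n. I + 1 / real (Suc n)) \<longlonglongrightarrow> I + 0"
    by (intro tendsto_intros LIMSEQ_Suc lim_1_over_n)
  ultimately have "\<psi> l \<le> I + 0"
    by (rule LIMSEQ_le) (use X(2) in \<open>auto intro: less_imp_le\<close>)
  then have "\<psi> l \<le> \<psi> v" if "v \<in> S" for v using I[OF that] by simp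
  then show ?thesis using l(1) unfolding \<psi>_def by blast
qed

section \<open>Coordinates, projection and completeness of \<open>Rd d\<close>\<close>

lift_definition trunc :: "nat \<Rightarrow> rvec \<Rightarrow> rvec" is "\<lambda>d x i. if i < d then x i else 0"
  by (rule finite_subset[rotated]) auto

lift_definition axis_vec :: "nat \<Rightarrow> rvec" is "\<lambda>j i. if i = j then 1 else 0"
  by simp

lemma coord_simps [simp]:
  "coord 0 i = 0" "coord (x + y) i = coord x i + coord y i" "coord (x - y) i = coord x i - coord y i"
  "coord (- x) i = - coord x i" "coord (r *\<^sub>R x) i = r * coord x i"
  "coord (trunc d x) i = (if i < d then coord x i else 0)"
  "coord (axis_vec j) i = (if i = j then 1 else 0)"
  by (simp_all add: zero_rvec.rep_eq plus_rvec.rep_eq minus_rvec.rep_eq uminus_rvec.rep_eq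
      scaleR_rvec.rep_eq trunc.rep_eq axis_vec.rep_eq)

lemma rvec_eq_iff: "x = y \<longleftrightarrow> (\<forall>i. coord x i = coord y i)"
  by (simp flip: coord_inject add: fun_eq_iff)

lemma subspace_Rd [simp]: "subspace (Rd d)"
  by (auto simp: subspace_def Rd_def)

lemmas Rd_closed [simp] =
  subspace_0[OF subspace_Rd] subspace_add[OF subspace_Rd] subspace_diff[OF subspace_Rd] subspace_neg[OF subspace_Rd]
  subspace_scale[OF subspace_Rd] subspace_sum[OF subspace_Rd]

lemma convex_Rd [simp]: "convex (Rd d)"
  by (simp add: subspace_imp_convex)

lemma trunc_in_Rd [simp]: "trunc d x \<in> Rd d"
  by (simp add: Rd_def)

lemma trunc_id [simp]: "x \<in> Rd d \<Longrightarrow> trunc d x = x"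
  by (auto simp: Rd_def rvec_eq_iff not_less)

lemma trunc_add: "trunc d (x + y) = trunc d x + trunc d y"
  and trunc_scaleR: "trunc d (r *\<^sub>R x) = r *\<^sub>R trunc d x"
  by (auto simp: rvec_eq_iff)

lemma norm_sq_Rd: "x \<in> Rd d \<Longrightarrow> (norm x)\<^sup>2 = (\<Sum>i<d. (coord x i)\<^sup>2)"
  unfolding power2_norm_eq_inner
  by (subst inner_rvec_eq_sum[of "{..<d}"]) (auto simp: Rd_def power2_eq_square intro: leI)

lemma abs_coord_le_norm: "\<bar>coord x i\<bar> \<le> norm x"
proof (rule power2_le_imp_le)
  have "finite (insert i {j. coord x j \<noteq> 0})" using coord[of x] by simp
  then have "(norm x)\<^sup>2 = (\<Sum>j\<in>insert i {j. coord x j \<noteq> 0}. coord x j * coord x j)"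
    unfolding power2_norm_eq_inner by (rule inner_rvec_eq_sum) auto
  also have "\<dots> \<ge> coord x i * coord x i"
    by (rule member_le_sum) (use coord[of x] in auto)
  finally show "\<bar>coord x i\<bar>\<^sup>2 \<le> (norm x)\<^sup>2" by (simp add: power2_eq_square)
qed simp

text \<open>Pythagoras: \<open>trunc d x\<close> and \<open>x - trunc d x\<close> have disjoint
  supports.\<close>

lemma norm_trunc_le: "norm (trunc d x) \<le> norm x"
proof (rule power2_le_imp_le)
  define e where "e = trunc d x"
  have "(norm x)\<^sup>2 = (norm e)\<^sup>2 + 2 * (e \<bullet> (x - e)) + (norm (x - e))\<^sup>2"
    unfolding power2_norm_eq_inner by (simp add: inner_diff inner_commute)
  moreover have "e \<bullet> (x - e) = (\<Sum>i<d. coord e i * coord (x - e) i)"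
    by (rule inner_rvec_eq_sum) (auto simp: e_def)
  then have "e \<bullet> (x - e) = 0" by (simp add: e_def)
  ultimately show "(norm (trunc d x))\<^sup>2 \<le> (norm x)\<^sup>2" by (simp add: e_def)
qed simp

text \<open>Coordinates are 1-Lipschitz, hence converge one by one, and the squared norm on
  \<open>Rd d\<close> is a sum of only \<open>d\<close> of them. The whole type \<open>rvec\<close>
  is not complete, so limits have to be taken inside some \<open>Rd d\<close>.\<close>

lemma complete_Rd: "Topological_Spaces.complete (Rd d)"
  unfolding Real_Vector_Spaces.complete_def
proof safe
  fix X assume X: "\<forall>n. X n \<in> Rd d" and C: "Cauchy X"
  have "Cauchy (\<lambda>n. coord (X n) i)" for i
  proof (rule metric_CauchyI)
    fix e :: real assume "0 < e"
    then obtain M where M: "\<And>m n. m \<ge> M \<Longrightarrow> n \<ge> M \<Longrightarrow> dist (X m) (X n) < e"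
      using metric_CauchyD[OF C] by metis
    have "dist (coord (X m) i) (coord (X n) i) \<le> dist (X m) (X n)" for m n
      using abs_coord_le_norm[of "X m - X n" i] by (simp add: dist_norm)
    then show "\<exists>M. \<forall>m\<ge>M. \<forall>n\<ge>M. dist (coord (X m) i) (coord (X n) i) < e"
      using M by (meson le_less_trans)
  qed
  then have "(\<lambda>n. coord (X n) i) \<longlonglongrightarrow> lim (\<lambda>n. coord (X n) i)" for i
    by (simp add: Cauchy_convergent_iff convergent_LIMSEQ_iff)
  then obtain L where L: "\<And>i. (\<lambda>n. coord (X n) i) \<longlonglongrightarrow> L i"
    by (rule that)
  define l where "l = (\<Sum>i<d. L i *\<^sub>R axis_vec i)"
  have coord_sum: "coord (sum f A) j = (\<Sum>i\<in>A. coord (f i) j)" for f :: "nat \<Rightarrow> rvec" and A j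
    by (induction A rule: infinite_finite_induct) auto
  have coord_l: "coord l i = (if i < d then L i else 0)" for i
    by (auto simp: l_def coord_sum if_distrib sum.delta cong: if_cong)
  then have l: "l \<in> Rd d" by (simp add: Rd_def)
  have "(\<lambda>n. (norm (X n - l))\<^sup>2) = (\<lambda>n. \<Sum>i<d. (coord (X n) i - L i)\<^sup>2)"
    using X l by (subst norm_sq_Rd[of _ d]) (auto simp: coord_l)
  moreover have "(\<lambda>n. \<Sum>i<d. (coord (X n) i - L i)\<^sup>2) \<longlonglongrightarrow> (\<Sum>i<d. (L i - L i)\<^sup>2)"
    by (intro tendsto_intros L)
  ultimately have "(\<lambda>n. (norm (X n - l))\<^sup>2) \<longlonglongrightarrow> 0" by simp
  from tendsto_real_sqrt[OF this] have "(\<lambda>n. norm (X n - l)) \<longlonglongrightarrow> 0" by simp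
  then have "X \<longlonglongrightarrow> l" by (simp add: LIM_zero_cancel tendsto_norm_zero_iff)
  with l show "\<exists>l\<in>Rd d. X \<longlonglongrightarrow> l" by blast
qed

text \<open>Induction on the dimension: a point of norm at most \<open>r\<close> is the midpoint of
  twice its truncation, which the induction hypothesis covers at radius \<open>2 * r\<close>, and of
  a point on the last axis, where a convex function is bounded by its values at the ends of a
  segment.\<close>

lemma convex_on_Rd_bounded_above:
  assumes "convex_on (Rd d) \<phi>"
  shows "\<exists>B. \<forall>x\<in>Rd d. norm x \<le> r \<longrightarrow> \<phi> x \<le> B"
  using assms
proof (induction d arbitrary: r)
  case 0
  have "Rd 0 = {0}" by (auto simp: Rd_def rvec_eq_iff)
  then show ?case by (intro exI[of _ "\<phi> 0"]) simp
next
  case (Suc d)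
  have sub: "Rd d \<subseteq> Rd (Suc d)" by (auto simp: Rd_def)
  then have "convex_on (Rd d) \<phi>" using Suc.prems convex_on_subset convex_Rd by blast
  then obtain B where B: "\<And>x. x \<in> Rd d \<Longrightarrow> norm x \<le> 2 * r \<Longrightarrow> \<phi> x \<le> B"
    using Suc.IH[of "2 * r"] by blast
  define e where "e = axis_vec d"
  have e: "e \<in> Rd (Suc d)" by (simp add: e_def Rd_def)
  define M where "M = max (\<phi> ((- 2 * r) *\<^sub>R e)) (\<phi> ((2 * r) *\<^sub>R e))"
  have "\<phi> x \<le> 1/2 * B + 1/2 * M" if x: "x \<in> Rd (Suc d)" "norm x \<le> r" for x
  proof -
    define t where "t = coord x d"
    have t: "\<bar>t\<bar> \<le> r" using abs_coord_le_norm[of x d] x by (simp add: t_def)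
    have x_eq: "x = (1 - 1/2) *\<^sub>R (2 *\<^sub>R trunc d x) + (1/2) *\<^sub>R ((2 * t) *\<^sub>R e)"
      using x(1) unfolding rvec_eq_iff by (auto simp: e_def t_def Rd_def)
    have "\<phi> (2 *\<^sub>R trunc d x) \<le> B"
      by (rule B) (use norm_trunc_le[of d x] x(2) in auto)
    moreover have "\<phi> ((2 * t) *\<^sub>R e) \<le> M"
    proof (cases "r = 0")
      case True
      with t show ?thesis by (simp add: M_def)
    next
      case False
      with t have r: "0 < r" by linarith
      define s where "s = (t + r) / (2 * r)"
      have s: "0 \<le> s" "s \<le> 1" using t r by (auto simp: s_def field_simps)
      have "2 * t = (1 - s) * (- 2 * r) + s * (2 * r)" using r by (simp add: s_def field_simps)
      then have "(2 * t) *\<^sub>R e = (1 - s) *\<^sub>R ((- 2 * r) *\<^sub>R e) + s *\<^sub>R ((2 * r) *\<^sub>R e)"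
        by (simp only: scaleR_left_distrib scaleR_scaleR)
      then have "\<phi> ((2 * t) *\<^sub>R e) \<le> (1 - s) * \<phi> ((- 2 * r) *\<^sub>R e) + s * \<phi> ((2 * r) *\<^sub>R e)"
        using convex_onD[OF Suc.prems s, of "(- 2 * r) *\<^sub>R e" "(2 * r) *\<^sub>R e"] e by simp
      also have "\<dots> \<le> (1 - s) * M + s * M"
        using s by (intro add_mono mult_left_mono) (auto simp: M_def)
      finally show ?thesis by (simp add: algebra_simps)
    qed
    moreover have "\<phi> x \<le> (1 - 1/2) * \<phi> (2 *\<^sub>R trunc d x) + 1/2 * \<phi> ((2 * t) *\<^sub>R e)"
      using convex_onD[OF Suc.prems, of "1/2" "2 *\<^sub>R trunc d x" "(2 * t) *\<^sub>R e"]
        e sub trunc_in_Rd[of d x] by (subst x_eq) (auto simp del: trunc_in_Rd)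
    ultimately show ?thesis by simp
  qed
  then show ?case by blast
qed

text \<open>Reflection: \<open>y\<close> is the midpoint of \<open>x\<close> and
  \<open>2 y - x\<close>, so an upper bound at the reflected point is a lower bound at
  \<open>x\<close>.\<close>

lemma convex_on_Rd_local_lower_bound:
  assumes cvx: "convex_on (Rd d) \<phi>" and y: "y \<in> Rd d" and x: "x \<in> Rd d"
    and B: "\<And>w. w \<in> Rd d \<Longrightarrow> norm w \<le> norm y + r \<Longrightarrow> \<phi> w \<le> B" and r: "norm (x - y) \<le> r"
  shows "2 * \<phi> y - B \<le> \<phi> x"
proof -
  have "\<phi> y \<le> (1 - 1/2) * \<phi> x + 1/2 * \<phi> (2 *\<^sub>R y - x)"
    using convex_onD[OF cvx, of "1/2" x "2 *\<^sub>R y - x"] x y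
    by (simp add: algebra_simps)
  moreover have "\<phi> (2 *\<^sub>R y - x) \<le> B"
  proof (rule B)
    have "2 *\<^sub>R y - x = y - (x - y)" by (simp add: scaleR_2)
    then have "norm (2 *\<^sub>R y - x) \<le> norm y + norm (x - y)" by (simp only: norm_triangle_ineq4)
    with r show "norm (2 *\<^sub>R y - x) \<le> norm y + r" by linarith
  qed (use x y in auto)
  ultimately show ?thesis by simp
qed

text \<open>\<open>Rd d\<close> has empty interior in \<open>rvec\<close>. Composing with the
  projection \<open>trunc d\<close> extends \<open>\<phi>\<close> to a convex function on the whole
  space that is bounded on every ball, hence continuous on open balls.\<close>

lemma convex_on_Rd_continuous:
  assumes cvx: "convex_on (Rd d) \<phi>"
  shows "continuous_on (Rd d) \<phi>"
proof -
  define f where "f x = \<phi> (trunc d x)" for x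
  have f: "convex_on UNIV f"
    by (rule convex_onI)
      (use convex_onD[OF cvx] in \<open>auto simp: f_def trunc_add trunc_scaleR\<close>)
  have "continuous_on (ball 0 r) f" for r
  proof -
    obtain B where B: "\<And>w. w \<in> Rd d \<Longrightarrow> norm w \<le> r \<Longrightarrow> \<phi> w \<le> B"
      using convex_on_Rd_bounded_above[OF cvx] by blast
    have bound: "\<bar>f x\<bar> \<le> \<bar>B\<bar> + \<bar>2 * \<phi> 0 - B\<bar>" if "x \<in> ball 0 r" for x
    proof -
      have x: "norm (trunc d x) \<le> r" using that norm_trunc_le[of d x] by simp
      have "2 * \<phi> 0 - B \<le> \<phi> (trunc d x)"
        by (rule convex_on_Rd_local_lower_bound[OF cvx, of 0 _ r]) (use x B in auto)
      then show ?thesis using B[OF _ x] by (simp add: f_def)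
    qed
    show ?thesis
      by (rule convex_on_bounded_continuous[OF open_ball convex_on_subset[OF f]])
        (use bound in auto)
  qed
  then have "isCont f x" for x
    using continuous_on_eq_continuous_at[of "ball 0 (norm x + 1)" f] by simp
  then have "continuous_on (Rd d) f" by (simp add: continuous_at_imp_continuous_on)
  then show ?thesis by (simp add: f_def cong: continuous_on_cong)
qed

text \<open>Along rays from \<open>y\<close> a convex function decreases at most linearly, with a
  slope \<open>M\<close> read off on the unit sphere around \<open>y\<close>; the quadratic term
  outweighs this.\<close>

lemma convex_plus_quadratic_bounded_below:
  assumes cvx: "convex_on (Rd d) \<phi>" and y: "y \<in> Rd d" and c: "0 < c"
  shows "\<exists>b. \<forall>v\<in>Rd d. b \<le> \<phi> v + c / 2 * (norm (v - y))\<^sup>2"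
proof -
  obtain B where B: "\<And>w. w \<in> Rd d \<Longrightarrow> norm w \<le> norm y + 1 \<Longrightarrow> \<phi> w \<le> B"
    using convex_on_Rd_bounded_above[OF cvx] by blast
  define M where "M = B - \<phi> y"
  have M: "0 \<le> M" using B[OF y] by (simp add: M_def)
  have low: "\<phi> y - M \<le> \<phi> x" if "x \<in> Rd d" "norm (x - y) \<le> 1" for x
    using convex_on_Rd_local_lower_bound[OF cvx y that(1) B that(2)] by (simp add: M_def)
  have "\<phi> y - M - M\<^sup>2 / (2 * c) \<le> \<phi> v + c / 2 * (norm (v - y))\<^sup>2" if v: "v \<in> Rd d" for v
  proof (cases "norm (v - y) \<le> 1")
    case True
    moreover have "0 \<le> M\<^sup>2 / (2 * c)" "0 \<le> c / 2 * (norm (v - y))\<^sup>2" using c by auto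
    ultimately show ?thesis using low[OF v] by linarith
  next
    case False
    define r where "r = norm (v - y)"
    have r: "1 < r" using False by (simp add: r_def)
    \<comment> \<open>The point where the segment from \<open>y\<close> to \<open>v\<close> crosses
      the unit sphere around \<open>y\<close>.\<close>
    define w where "w = (1 - 1/r) *\<^sub>R y + (1/r) *\<^sub>R v"
    have "w - y = (1/r) *\<^sub>R (v - y)" by (simp add: w_def algebra_simps)
    then have "norm (w - y) = 1" using r by (simp add: r_def[symmetric])
    then have "\<phi> y - M \<le> \<phi> w" using v y by (intro low) (auto simp: w_def)
    also have "\<phi> w \<le> (1 - 1/r) * \<phi> y + 1/r * \<phi> v"
      unfolding w_def using r v y by (intro convex_onD[OF cvx]) auto
    finally have "r * (\<phi> y - M) \<le> r * ((1 - 1/r) * \<phi> y + 1/r * \<phi> v)"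
      using r by (intro mult_left_mono) auto
    also have "\<dots> = (r - 1) * \<phi> y + \<phi> v" using r by (simp add: field_simps)
    finally have 1: "\<phi> y - r * M \<le> \<phi> v" by (simp add: algebra_simps)
    \<comment> \<open>Completing the square: \<open>c / 2 * r^2 - r * M\<close> is never below
      \<open>- M^2 / (2 * c)\<close>.\<close>
    have "0 \<le> (c * r - M)\<^sup>2 / (2 * c)" using c by simp
    also have "(c * r - M)\<^sup>2 / (2 * c) = c / 2 * r\<^sup>2 - r * M + M\<^sup>2 / (2 * c)"
      using c by (simp add: field_simps power2_eq_square)
    finally show ?thesis using 1 M unfolding r_def[symmetric] by linarith
  qed
  then show ?thesis by blast
qed

lemma convex_plus_quadratic_attains_min_Rd:
  assumes "convex_on (Rd d) \<phi>" "y \<in> Rd d" "0 < c"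
  shows "\<exists>u\<in>Rd d. \<forall>v\<in>Rd d. \<phi> u + c / 2 * (norm (u - y))\<^sup>2 \<le> \<phi> v + c / 2 * (norm (v - y))\<^sup>2"
proof -
  obtain b where "\<And>v. v \<in> Rd d \<Longrightarrow> b \<le> \<phi> v + c / 2 * (norm (v - y))\<^sup>2"
    using convex_plus_quadratic_bounded_below[OF assms] by blast
  then show ?thesis
    using assms by (intro convex_plus_quadratic_attains_min complete_Rd convex_on_Rd_continuous) auto
qed

section \<open>Smooth convex functions\<close>

lemma smooth_on_Rd_derivative_along_line:
  assumes sm: "smooth_on_Rd d L \<phi> G" and x: "x \<in> Rd d" and v: "v \<in> Rd d"
  shows "((\<lambda>t. \<phi> (x + t *\<^sub>R v)) has_real_derivative G (x + t *\<^sub>R v) \<bullet> v) (at t)"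
proof -
  define l where "l t = x + t *\<^sub>R v" for t
  have l: "l t \<in> Rd d" for t using x v by (simp add: l_def)
  have "(l has_derivative (\<lambda>s. s *\<^sub>R v)) (at t)"
    unfolding l_def by (auto intro!: derivative_eq_intros)
  moreover have "(\<phi> has_derivative (\<lambda>w. G (l t) \<bullet> w)) (at (l t) within range l)"
  proof (rule has_derivative_subset)
    show "(\<phi> has_derivative (\<lambda>w. G (l t) \<bullet> w)) (at (l t) within Rd d)"
      using sm l[of t] unfolding smooth_on_Rd_def by blast
    show "range l \<subseteq> Rd d" using l by blast
  qed
  ultimately have "(\<phi> \<circ> l has_derivative (\<lambda>w. G (l t) \<bullet> w) \<circ> (\<lambda>s. s *\<^sub>R v)) (at t)"
    by (rule diff_chain_within)
  then show ?thesis
    by (simp add: has_field_derivative_def l_def o_def mult_commute_abs)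
qed

text \<open>Along the segment from \<open>x\<close> to \<open>y\<close>, \<open>\<psi>\<close> is
  \<open>\<phi>\<close> minus the linear and quadratic terms of the bound; Cauchy-Schwarz and the
  Lipschitz gradient make its derivative nonpositive.\<close>

lemma smooth_on_Rd_descent:
  assumes sm: "smooth_on_Rd d L \<phi> G" and x: "x \<in> Rd d" and y: "y \<in> Rd d"
  shows "\<phi> y \<le> \<phi> x + G x \<bullet> (y - x) + L / 2 * (norm (y - x))\<^sup>2"
proof -
  define v where "v = y - x"
  have v: "v \<in> Rd d" using x y by (simp add: v_def)
  define \<psi> where "\<psi> t = \<phi> (x + t *\<^sub>R v) - t * (G x \<bullet> v) - L / 2 * t\<^sup>2 * (norm v)\<^sup>2" for t
  have "(\<psi> has_real_derivative (G (x + t *\<^sub>R v) - G x) \<bullet> v - L * t * (norm v)\<^sup>2) (at t)" for t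
    unfolding \<psi>_def
    by (auto intro!: derivative_eq_intros smooth_on_Rd_derivative_along_line[OF sm x v]
        simp: inner_diff_left)
  moreover have "(G (x + t *\<^sub>R v) - G x) \<bullet> v - L * t * (norm v)\<^sup>2 \<le> 0" if "0 \<le> t" for t
  proof -
    have "(G (x + t *\<^sub>R v) - G x) \<bullet> v \<le> norm (G (x + t *\<^sub>R v) - G x) * norm v"
      by (rule norm_cauchy_schwarz)
    also have "norm (G (x + t *\<^sub>R v) - G x) \<le> L * norm (x + t *\<^sub>R v - x)"
      using sm x v unfolding smooth_on_Rd_def by (metis Rd_closed(2,5))
    then have "norm (G (x + t *\<^sub>R v) - G x) * norm v \<le> L * norm (x + t *\<^sub>R v - x) * norm v"
      by (rule mult_right_mono) simp
    finally show ?thesis using that by (simp add: power2_eq_square)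
  qed
  ultimately have "\<psi> 1 \<le> \<psi> 0"
    by (intro DERIV_nonpos_imp_nonincreasing[of 0 1 \<psi>]) (simp, blast)
  then show ?thesis by (simp add: \<psi>_def v_def)
qed

text \<open>Restricting to the line through \<open>x\<close> and \<open>y\<close> leaves the
  one-variable tangent inequality.\<close>

lemma smooth_convex_above_tangent:
  assumes sm: "smooth_on_Rd d L \<phi> G" and cvx: "convex_on (Rd d) \<phi>"
    and x: "x \<in> Rd d" and y: "y \<in> Rd d"
  shows "\<phi> x + G x \<bullet> (y - x) \<le> \<phi> y"
proof -
  define v where "v = y - x"
  have v: "v \<in> Rd d" using x y by (simp add: v_def)
  define \<psi> where "\<psi> t = \<phi> (x + t *\<^sub>R v)" for t
  have "convex_on UNIV \<psi>"
  proof (rule convex_onI)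
    fix t a b :: real assume t: "0 < t" "t < 1"
    have "x + ((1 - t) *\<^sub>R a + t *\<^sub>R b) *\<^sub>R v = (1 - t) *\<^sub>R (x + a *\<^sub>R v) + t *\<^sub>R (x + b *\<^sub>R v)"
      by (simp add: algebra_simps)
    then show "\<psi> ((1 - t) *\<^sub>R a + t *\<^sub>R b) \<le> (1 - t) * \<psi> a + t * \<psi> b"
      unfolding \<psi>_def using convex_onD[OF cvx, of t "x + a *\<^sub>R v" "x + b *\<^sub>R v"] t x v by simp
  qed simp
  moreover have "(\<psi> has_real_derivative G (x + 0 *\<^sub>R v) \<bullet> v) (at 0)"
    unfolding \<psi>_def by (rule smooth_on_Rd_derivative_along_line[OF sm x v])
  ultimately have "\<psi> 1 - \<psi> 0 \<ge> G (x + 0 *\<^sub>R v) \<bullet> v * (1 - 0)"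
    by (intro convex_on_imp_above_tangent[of UNIV]) auto
  then show ?thesis by (simp add: \<psi>_def v_def)
qed

text \<open>Subtracting the linear function with slope \<open>G x\<close> makes \<open>x\<close> a
  minimizer. The point \<open>w\<close> is then a gradient step of length \<open>1 / L\<close> from
  \<open>y\<close>: the tangent at \<open>x\<close> bounds the value at \<open>w\<close> from below,
  the descent inequality at \<open>y\<close> from above.\<close>

lemma smooth_convex_cocoercive:
  assumes sm: "smooth_on_Rd d L \<phi> G" and cvx: "convex_on (Rd d) \<phi>" and L: "0 < L"
    and x: "x \<in> Rd d" and y: "y \<in> Rd d"
  shows "(norm (G x - G y))\<^sup>2 \<le> 2 * L * (\<phi> y - \<phi> x - G x \<bullet> (y - x))"
proof -
  define e where "e = G y - G x"
  have e: "e \<in> Rd d" using sm x y by (simp add: e_def smooth_on_Rd_def)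
  define w where "w = y - (1 / L) *\<^sub>R e"
  have w: "w \<in> Rd d" using y e by (simp add: w_def)
  have "\<phi> x + G x \<bullet> (w - x) \<le> \<phi> w" by (rule smooth_convex_above_tangent[OF sm cvx x w])
  moreover have "\<phi> w \<le> \<phi> y + G y \<bullet> (w - y) + L / 2 * (norm (w - y))\<^sup>2"
    by (rule smooth_on_Rd_descent[OF sm y w])
  moreover have "G x \<bullet> (w - x) = G x \<bullet> (y - x) + G x \<bullet> (w - y)" by (simp add: inner_diff_right)
  moreover have "G y \<bullet> (w - y) = G x \<bullet> (w - y) + e \<bullet> (w - y)" by (simp add: e_def inner_diff_left)
  moreover have "e \<bullet> (w - y) = - (norm e)\<^sup>2 / L" by (simp add: w_def power2_norm_eq_inner)
  moreover have "L / 2 * (norm (w - y))\<^sup>2 = (norm e)\<^sup>2 / (2 * L)"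
    using L by (simp add: w_def power2_eq_square field_simps)
  ultimately have "(norm e)\<^sup>2 / L - (norm e)\<^sup>2 / (2 * L) \<le> \<phi> y - \<phi> x - G x \<bullet> (y - x)" by simp
  then have "(norm e)\<^sup>2 / (2 * L) \<le> \<phi> y - \<phi> x - G x \<bullet> (y - x)" by (simp add: field_simps)
  then have "(norm e)\<^sup>2 \<le> 2 * L * (\<phi> y - \<phi> x - G x \<bullet> (y - x))" using L by (simp add: field_simps)
  then show ?thesis by (simp add: e_def norm_minus_commute)
qed

section \<open>Finitely supported Markov chains\<close>

lemma expectation_bind_pmf_finite:
  fixes f :: "'b \<Rightarrow> real"
  assumes "finite (set_pmf p)" "\<And>x. x \<in> set_pmf p \<Longrightarrow> finite (set_pmf (K x))"
  shows "measure_pmf.expectation (bind_pmf p K) f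
    = measure_pmf.expectation p (\<lambda>x. measure_pmf.expectation (K x) f)"
  using assms by (simp add: pmf_expectation_bind[of "set_pmf p"] integral_measure_pmf[of "set_pmf p"])

lemma expectation_mono_finite:
  fixes f g :: "'a \<Rightarrow> real"
  assumes "finite (set_pmf p)" "\<And>x. x \<in> set_pmf p \<Longrightarrow> f x \<le> g x"
  shows "measure_pmf.expectation p f \<le> measure_pmf.expectation p g"
  using assms by (intro integral_mono_AE integrable_measure_pmf_finite) (auto simp: AE_measure_pmf_iff)

lemma expectation_affine_finite:
  fixes f :: "'a \<Rightarrow> real"
  assumes "finite (set_pmf p)"
  shows "measure_pmf.expectation p (\<lambda>x. a * f x + b) = a * measure_pmf.expectation p f + b"
  using assms by (simp add: integrable_measure_pmf_finite)

lemma iterate_pmf_0 [simp]: "iterate_pmf 0 K s = return_pmf s"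
  and iterate_pmf_Suc [simp]: "iterate_pmf (Suc k) K s = bind_pmf (iterate_pmf k K s) K"
  by (simp_all add: iterate_pmf_def)

lemma iterate_pmf_map:
  assumes "\<And>s. K (g s) = map_pmf g (K s)"
  shows "iterate_pmf k K (g s) = map_pmf g (iterate_pmf k K s)"
  by (induction k) (simp_all add: assms bind_map_pmf map_bind_pmf)

text \<open>A supermartingale argument with drift: \<open>I t\<close> holds surely after
  \<open>t\<close> transitions, and the expected potential \<open>V t\<close> rises by at most
  \<open>b\<close> per transition. It is applied at three levels: to steps, to epochs and to
  restarts.\<close>

lemma iterate_pmf_drift:
  fixes V :: "nat \<Rightarrow> 's \<Rightarrow> real"
  assumes init: "I 0 s"
    and step: "\<And>t s. I t s \<Longrightarrow> finite (set_pmf (K s)) \<and> (\<forall>s'\<in>set_pmf (K s). I (Suc t) s')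
      \<and> measure_pmf.expectation (K s) (V (Suc t)) \<le> V t s + b"
  shows "finite (set_pmf (iterate_pmf k K s)) \<and> (\<forall>s'\<in>set_pmf (iterate_pmf k K s). I k s')
    \<and> measure_pmf.expectation (iterate_pmf k K s) (V k) \<le> V 0 s + real k * b"
proof (induction k)
  case 0
  then show ?case using init by simp
next
  case (Suc k)
  let ?M = "iterate_pmf k K s"
  have "measure_pmf.expectation (iterate_pmf (Suc k) K s) (V (Suc k))
      = measure_pmf.expectation ?M (\<lambda>s. measure_pmf.expectation (K s) (V (Suc k)))"
    unfolding iterate_pmf_Suc using Suc step by (intro expectation_bind_pmf_finite) blast+
  also have "\<dots> \<le> measure_pmf.expectation ?M (\<lambda>s. 1 * V k s + b)"
    using Suc step by (intro expectation_mono_finite) auto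
  also have "\<dots> = measure_pmf.expectation ?M (V k) + b"
    using Suc by (subst expectation_affine_finite) auto
  also have "\<dots> \<le> V 0 s + real (Suc k) * b" using Suc by (simp add: algebra_simps)
  finally show ?case using Suc step by auto
qed

section \<open>One step of ASVRG\<close>

locale composite_problem =
  fixes Q :: finite_sum
  assumes problem: "finite_sum_problem Q"
begin

abbreviation "n \<equiv> size_n Q"
abbreviation "X \<equiv> Rd (vdim Q)"
abbreviation "p \<equiv> pmf (samp Q)"
abbreviation "\<Lambda> \<equiv> Ltilde Q"
abbreviation "g \<equiv> full_grad Q"

definition smooth_part :: "rvec \<Rightarrow> real" where
  "smooth_part x = (\<Sum>i<n. component Q i x) / real n"

lemma objective_eq: "objective Q x = smooth_part x + reg Q x"
  by (simp add: objective_def smooth_part_def)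

lemma set_samp: "set_pmf (samp Q) = {..<n}"
  and lip_pos: "i < n \<Longrightarrow> 0 < lip Q i"
  and convex_component: "i < n \<Longrightarrow> convex_on X (component Q i)"
  and smooth_component: "i < n \<Longrightarrow> smooth_on_Rd (vdim Q) (lip Q i) (component Q i) (grad Q i)"
  and convex_reg: "convex_on X (reg Q)"
  using problem by (auto simp: finite_sum_problem_def)

lemma n_pos: "0 < n"
  using set_pmf_not_empty[of "samp Q"] set_samp by (cases n) auto

lemma p_pos: "i < n \<Longrightarrow> 0 < p i"
  using set_samp by (auto simp: pmf_positive)

lemma sum_p: "(\<Sum>i<n. p i) = 1"
  by (rule sum_pmf_eq_1) (auto simp: set_samp)

lemma finite_samp [simp]: "finite (set_pmf (samp Q))"
  by (simp add: set_samp)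

lemma expectation_samp:
  fixes h :: "nat \<Rightarrow> real"
  shows "measure_pmf.expectation (samp Q) h = (\<Sum>i<n. p i * h i)"
  by (subst integral_measure_pmf[of "{..<n}"]) (auto simp: set_samp)

lemma lip_le: "i < n \<Longrightarrow> lip Q i \<le> \<Lambda> * (real n * p i)"
proof -
  assume i: "i < n"
  then have "lip Q i / (real n * p i) \<le> \<Lambda>"
    unfolding Ltilde_def by (intro Max_ge) auto
  then show ?thesis using i n_pos p_pos[OF i] by (simp add: field_simps)
qed

lemma Ltilde_pos: "0 < \<Lambda>"
proof -
  have "0 < \<Lambda> * (real n * p 0)" using lip_le[of 0] lip_pos[of 0] n_pos by simp
  moreover have "0 < real n * p 0" using p_pos[of 0] n_pos by simp
  ultimately show ?thesis by (rule zero_less_mult_pos2)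
qed

lemma full_grad_inner: "g x \<bullet> w = (\<Sum>i<n. grad Q i x \<bullet> w) / real n"
  by (simp add: full_grad_def inner_sum_left divide_inverse_commute)

text \<open>The averaged constant is \<open>\<Lambda>\<close> because each \<open>lip Q i\<close> is
  at most \<open>\<Lambda> * (n * p i)\<close> and the probabilities sum to 1.\<close>

lemma smooth_part_descent:
  assumes "x \<in> X" "y \<in> X"
  shows "smooth_part y \<le> smooth_part x + g x \<bullet> (y - x) + \<Lambda> / 2 * (norm (y - x))\<^sup>2"
proof -
  have "(\<Sum>i<n. component Q i y)
      \<le> (\<Sum>i<n. component Q i x + grad Q i x \<bullet> (y - x) + real n * p i * (\<Lambda> / 2 * (norm (y - x))\<^sup>2))"
  proof (rule sum_mono)
    fix i assume "i \<in> {..<n}"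
    then have i: "i < n" by simp
    have "lip Q i * ((norm (y - x))\<^sup>2 / 2) \<le> \<Lambda> * (real n * p i) * ((norm (y - x))\<^sup>2 / 2)"
      by (intro mult_right_mono lip_le i) simp
    with smooth_on_Rd_descent[OF smooth_component[OF i] assms]
    show "component Q i y \<le> component Q i x + grad Q i x \<bullet> (y - x)
        + real n * p i * (\<Lambda> / 2 * (norm (y - x))\<^sup>2)" by (simp add: algebra_simps)
  qed
  also have "\<dots> = (\<Sum>i<n. component Q i x) + (\<Sum>i<n. grad Q i x \<bullet> (y - x))
      + (\<Sum>i<n. p i) * (real n * (\<Lambda> / 2 * (norm (y - x))\<^sup>2))"
    unfolding sum.distrib sum_distrib_right by (simp add: mult_ac)
  finally show ?thesis
    unfolding smooth_part_def full_grad_inner sum_p using n_pos by (simp add: field_simps)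
qed

lemma smooth_part_above_tangent:
  assumes "x \<in> X" "y \<in> X"
  shows "smooth_part x + g x \<bullet> (y - x) \<le> smooth_part y"
proof -
  have "(\<Sum>i<n. component Q i x + grad Q i x \<bullet> (y - x)) \<le> (\<Sum>i<n. component Q i y)"
    by (intro sum_mono smooth_convex_above_tangent[OF smooth_component convex_component] assms) auto
  then show ?thesis
    unfolding smooth_part_def full_grad_inner sum.distrib
    by (simp add: add_divide_distrib[symmetric] divide_right_mono)
qed

lemma convex_smooth_part: "convex_on X smooth_part"
proof -
  have "convex_on X (\<lambda>x. \<Sum>i\<in>I. component Q i x)" if "finite I" "I \<subseteq> {..<n}" for I
    using that by (induction I rule: finite_induct) (auto simp: convex_on_const intro!: convex_on_add convex_component)
  then show ?thesis unfolding smooth_part_def by (intro convex_on_cdiv) auto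
qed

lemma convex_objective: "convex_on X (objective Q)"
  using convex_on_add[OF convex_smooth_part convex_reg] by (simp add: objective_eq[abs_def])

section \<open>Mean and variance of the gradient estimator\<close>

definition estimator :: "rvec \<Rightarrow> rvec \<Rightarrow> nat \<Rightarrow> rvec" where
  "estimator z x i = (grad Q i x - grad Q i z) /\<^sub>R (real n * p i) + g z"

lemma estimator_unbiased: "(\<Sum>i<n. p i * (estimator z x i \<bullet> w)) = g x \<bullet> w"
proof -
  have "(\<Sum>i<n. p i * (estimator z x i \<bullet> w))
      = (\<Sum>i<n. (grad Q i x \<bullet> w - grad Q i z \<bullet> w) / real n + p i * (g z \<bullet> w))"
  proof (rule sum.cong)
    fix i assume "i \<in> {..<n}"
    then show "p i * (estimator z x i \<bullet> w) = (grad Q i x \<bullet> w - grad Q i z \<bullet> w) / real n + p i * (g z \<bullet> w)"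
      using p_pos[of i] n_pos by (simp add: estimator_def inner_add_left inner_diff_left field_simps)
  qed simp
  also have "\<dots> = g x \<bullet> w"
    by (simp add: sum.distrib sum_distrib_right[symmetric] sum_p sum_divide_distrib[symmetric]
        sum_subtractf diff_divide_distrib full_grad_inner)
  finally show ?thesis .
qed

text \<open>The variance is at most the second moment about \<open>g z\<close>. There co-coercivity
  bounds each component by its Bregman distance, and the importance weights replace
  \<open>lip Q i / (n * p i)\<close> by \<open>\<Lambda>\<close>.\<close>

lemma estimator_variance:
  assumes x: "x \<in> X" and z: "z \<in> X"
  shows "(\<Sum>i<n. p i * (norm (estimator z x i - g x))\<^sup>2)
    \<le> 2 * \<Lambda> * (smooth_part z - smooth_part x - g x \<bullet> (z - x))"
proof -
  define e where "e i = estimator z x i - g z" for i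
  define \<Delta> where "\<Delta> = g x - g z"
  \<comment> \<open>The estimator has mean \<open>g x\<close>, so \<open>e\<close> has mean
    \<open>\<Delta>\<close>, and the second moment of \<open>e\<close> exceeds the variance by
    exactly \<open>\<Delta> \<bullet> \<Delta>\<close>.\<close>
  have mean: "(\<Sum>i<n. p i * (e i \<bullet> \<Delta>)) = \<Delta> \<bullet> \<Delta>"
    by (simp add: e_def inner_diff_left right_diff_distrib sum_subtractf estimator_unbiased
        sum_distrib_right[symmetric] sum_p) (simp add: \<Delta>_def inner_diff_left)
  have "(\<Sum>i<n. p i * (norm (estimator z x i - g x))\<^sup>2)
      = (\<Sum>i<n. p i * (norm (e i))\<^sup>2 - 2 * (p i * (e i \<bullet> \<Delta>)) + p i * (\<Delta> \<bullet> \<Delta>))"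
  proof (rule sum.cong)
    fix i
    have "estimator z x i - g x = e i - \<Delta>" by (simp add: e_def \<Delta>_def)
    then have "(norm (estimator z x i - g x))\<^sup>2 = (norm (e i))\<^sup>2 - 2 * (e i \<bullet> \<Delta>) + \<Delta> \<bullet> \<Delta>"
      by (simp only: power2_norm_eq_inner) (simp add: inner_diff inner_commute)
    then show "p i * (norm (estimator z x i - g x))\<^sup>2
        = p i * (norm (e i))\<^sup>2 - 2 * (p i * (e i \<bullet> \<Delta>)) + p i * (\<Delta> \<bullet> \<Delta>)"
      by (simp only:) (simp add: algebra_simps)
  qed simp
  also have "\<dots> = (\<Sum>i<n. p i * (norm (e i))\<^sup>2) - \<Delta> \<bullet> \<Delta>"
    by (simp add: sum.distrib sum_subtractf sum_distrib_left[symmetric] sum_distrib_right[symmetric]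
        sum_p mean)
  also have "\<dots> \<le> (\<Sum>i<n. p i * (norm (e i))\<^sup>2)" by simp
  also have "\<dots> \<le> (\<Sum>i<n. 2 * \<Lambda> / real n * (component Q i z - component Q i x - grad Q i x \<bullet> (z - x)))"
  proof (rule sum_mono)
    fix i assume "i \<in> {..<n}"
    then have i: "i < n" by simp
    define D where "D = component Q i z - component Q i x - grad Q i x \<bullet> (z - x)"
    have np: "0 < real n * p i" using n_pos p_pos[OF i] by simp
    have D: "0 \<le> D"
      using smooth_convex_above_tangent[OF smooth_component[OF i] convex_component[OF i] x z]
      by (simp add: D_def)
    have "(norm (grad Q i x - grad Q i z))\<^sup>2 \<le> 2 * lip Q i * D"
      unfolding D_def
      by (rule smooth_convex_cocoercive[OF smooth_component[OF i] convex_component[OF i] lip_pos[OF i] x z])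
    also have "\<dots> \<le> 2 * (\<Lambda> * (real n * p i)) * D"
      using lip_le[OF i] D by (intro mult_right_mono mult_left_mono) auto
    finally have *: "(norm (grad Q i x - grad Q i z))\<^sup>2 \<le> 2 * (\<Lambda> * (real n * p i)) * D" .
    have "norm (e i) = norm (grad Q i x - grad Q i z) / (real n * p i)"
      using np by (simp add: e_def estimator_def abs_mult divide_inverse_commute)
    then have "p i * (norm (e i))\<^sup>2 = p i * ((norm (grad Q i x - grad Q i z))\<^sup>2 / (real n * p i)\<^sup>2)"
      by (simp add: power_divide)
    also have "\<dots> \<le> p i * (2 * (\<Lambda> * (real n * p i)) * D / (real n * p i)\<^sup>2)"
      using * by (intro mult_left_mono divide_right_mono) auto
    also have "\<dots> = 2 * \<Lambda> / real n * D"
      using n_pos p_pos[OF i] by (simp add: power2_eq_square field_simps)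
    finally show "p i * (norm (e i))\<^sup>2
        \<le> 2 * \<Lambda> / real n * (component Q i z - component Q i x - grad Q i x \<bullet> (z - x))"
      by (simp add: D_def)
  qed
  also have "\<dots> = 2 * \<Lambda> * (smooth_part z - smooth_part x - g x \<bullet> (z - x))"
    unfolding sum_distrib_left[symmetric] sum_subtractf smooth_part_def full_grad_inner
    by (simp add: diff_divide_distrib right_diff_distrib)
  finally show ?thesis .
qed

text \<open>The linear term is absorbed into the convex part, so the three-point inequality is
  quadratic growth at a minimum.\<close>

lemma prox_step:
  fixes v y :: rvec and c :: real
  defines "y' \<equiv> arg_min_on (\<lambda>u. v \<bullet> (u - y) + c / 2 * (norm (u - y))\<^sup>2 + reg Q u) X"
  assumes y: "y \<in> X" and c: "0 < c"
  shows "y' \<in> X"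
    and "u \<in> X \<Longrightarrow> v \<bullet> (y' - y) + c / 2 * (norm (y' - y))\<^sup>2 + reg Q y' + c / 2 * (norm (u - y'))\<^sup>2
      \<le> v \<bullet> (u - y) + c / 2 * (norm (u - y))\<^sup>2 + reg Q u"
proof -
  define \<phi> where "\<phi> u = v \<bullet> (u - y) + reg Q u" for u
  define \<psi> where "\<psi> u = v \<bullet> (u - y) + c / 2 * (norm (u - y))\<^sup>2 + reg Q u" for u
  have \<psi>: "\<psi> u = \<phi> u + c / 2 * (norm (u - y))\<^sup>2" for u by (simp add: \<psi>_def \<phi>_def)
  have "convex_on X (\<lambda>u. v \<bullet> (u - y))"
    by (rule convex_onI) (simp_all add: inner_diff_right inner_add_right algebra_simps)
  then have cvx: "convex_on X \<phi>" unfolding \<phi>_def by (intro convex_on_add convex_reg)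
  obtain m where "m \<in> X" "\<forall>u\<in>X. \<psi> m \<le> \<psi> u"
    using convex_plus_quadratic_attains_min_Rd[OF cvx y c] unfolding \<psi> by blast
  then have "is_arg_min \<psi> (\<lambda>u. u \<in> X) m" by (auto simp: is_arg_min_linorder)
  \<comment> \<open>\<open>arg_min_on\<close> is a choice operator; it yields a minimizer because
    one has just been shown to exist.\<close>
  then have "is_arg_min \<psi> (\<lambda>u. u \<in> X) y'"
    unfolding y'_def arg_min_on_def arg_min_def \<psi>_def[symmetric] by (rule someI)
  then have y': "y' \<in> X" "\<And>u. u \<in> X \<Longrightarrow> \<psi> y' \<le> \<psi> u" by (auto simp: is_arg_min_linorder)
  then show "y' \<in> X" by simp
  assume "u \<in> X"
  from quadratic_growth_at_minimum[OF cvx y'(1) this, of c y] y'(2)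
  have "\<psi> y' + c / 2 * (norm (u - y'))\<^sup>2 \<le> \<psi> u" unfolding \<psi> by simp
  then show "v \<bullet> (y' - y) + c / 2 * (norm (y' - y))\<^sup>2 + reg Q y' + c / 2 * (norm (u - y'))\<^sup>2
      \<le> v \<bullet> (u - y) + c / 2 * (norm (u - y))\<^sup>2 + reg Q u" unfolding \<psi>_def .
qed

end

section \<open>Expected progress of one step\<close>

locale asvrg_run = composite_problem +
  fixes A :: asvrg_params
  assumes admissible: "admissible_params Q A"
begin

abbreviation "\<eta> \<equiv> stepsize A"
abbreviation "\<omega> \<equiv> momentum A"
abbreviation "m \<equiv> epoch_len A"
abbreviation "F \<equiv> objective Q"

lemma params: "0 < \<eta>" "\<Lambda> * \<eta> < 1" "0 < \<omega>" "\<Lambda> * \<eta> / (1 - \<Lambda> * \<eta>) \<le> 1 - \<omega>" "0 < m"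
  using admissible Ltilde_pos by (auto simp: admissible_params_def field_simps)

lemma momentum_less_1: "\<omega> < 1"
proof -
  have "0 < \<Lambda> * \<eta> / (1 - \<Lambda> * \<eta>)" using params Ltilde_pos by simp
  then show ?thesis using params(4) by simp
qed

definition next_y :: "rvec \<Rightarrow> rvec \<Rightarrow> rvec \<Rightarrow> nat \<Rightarrow> rvec" where
  "next_y z x y i = arg_min_on (\<lambda>u. estimator z x i \<bullet> (u - y)
     + \<omega> / (2 * \<eta>) * (norm (u - y))\<^sup>2 + reg Q u) X"

lemma asvrg_step_eq:
  "asvrg_step Q A z (x, y, a, c) = map_pmf (\<lambda>i. let y' = next_y z x y i; x' = z + \<omega> *\<^sub>R (y' - z)
     in (x', y', a + x', c + 2)) (samp Q)"
  by (simp add: asvrg_step_def next_y_def estimator_def Let_def)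

lemma next_y:
  assumes y: "y \<in> X"
  shows "next_y z x y i \<in> X"
    and "u \<in> X \<Longrightarrow> estimator z x i \<bullet> (next_y z x y i - y)
        + \<omega> / (2 * \<eta>) * (norm (next_y z x y i - y))\<^sup>2 + reg Q (next_y z x y i)
        + \<omega> / (2 * \<eta>) * (norm (u - next_y z x y i))\<^sup>2
      \<le> estimator z x i \<bullet> (u - y) + \<omega> / (2 * \<eta>) * (norm (u - y))\<^sup>2 + reg Q u"
proof -
  have eq: "\<omega> / (2 * \<eta>) = (\<omega> / \<eta>) / 2" by simp
  have c: "0 < \<omega> / \<eta>" using params by simp
  show "next_y z x y i \<in> X" unfolding next_y_def eq by (rule prox_step(1)[OF y c])
  show "u \<in> X \<Longrightarrow> estimator z x i \<bullet> (next_y z x y i - y)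
        + \<omega> / (2 * \<eta>) * (norm (next_y z x y i - y))\<^sup>2 + reg Q (next_y z x y i)
        + \<omega> / (2 * \<eta>) * (norm (u - next_y z x y i))\<^sup>2
      \<le> estimator z x i \<bullet> (u - y) + \<omega> / (2 * \<eta>) * (norm (u - y))\<^sup>2 + reg Q u"
    unfolding next_y_def eq by (rule prox_step(2)[OF y c])
qed

text \<open>The bound for a single sampled index, before taking expectations. The weight
  \<open>1 / \<eta>\<close> is split into \<open>\<Lambda>\<close>, spent on the descent inequality,
  and \<open>\<beta>\<close>, spent on the error of the estimator.\<close>

lemma step_descent:
  fixes z y u :: rvec and i :: nat
  defines "x \<equiv> z + \<omega> *\<^sub>R (y - z)" and "\<beta> \<equiv> 1 / \<eta> - \<Lambda>"
  defines "y' \<equiv> next_y z x y i"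
  assumes z: "z \<in> X" and y: "y \<in> X" and u: "u \<in> X"
  shows "F (z + \<omega> *\<^sub>R (y' - z)) + \<omega>\<^sup>2 / (2 * \<eta>) * (norm (u - y'))\<^sup>2
    \<le> smooth_part x + \<omega> * (estimator z x i \<bullet> (u - y)) + (norm (estimator z x i - g x))\<^sup>2 / (2 * \<beta>)
      + (1 - \<omega>) * reg Q z + \<omega> * reg Q u + \<omega>\<^sup>2 / (2 * \<eta>) * (norm (u - y))\<^sup>2"
proof -
  define x' where "x' = z + \<omega> *\<^sub>R (y' - z)"
  define e where "e = estimator z x i"
  have x: "x \<in> X" using y z by (simp add: x_def)
  have y': "y' \<in> X" unfolding y'_def by (rule next_y(1)[OF y])
  have x': "x' \<in> X" using y' z by (simp add: x'_def)
  \<comment> \<open>The coupling of \<open>x\<close> to \<open>y\<close> scales a proximal move by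
    \<open>\<omega>\<close>; this is where the factor \<open>\<omega>^2\<close> comes from.\<close>
  have d: "x' - x = \<omega> *\<^sub>R (y' - y)" by (simp add: x'_def x_def algebra_simps)
  have \<beta>: "0 < \<beta>" using params by (simp add: \<beta>_def field_simps)
  have 1: "smooth_part x' \<le> smooth_part x + g x \<bullet> (x' - x) + \<Lambda> / 2 * (norm (x' - x))\<^sup>2"
    by (rule smooth_part_descent[OF x x'])
  \<comment> \<open>Cauchy-Schwarz, then Young's inequality with weight
    \<open>\<beta>\<close>.\<close>
  have 2: "(g x - e) \<bullet> (x' - x) \<le> (norm (e - g x))\<^sup>2 / (2 * \<beta>) + \<beta> / 2 * (norm (x' - x))\<^sup>2"
  proof -
    have "(g x - e) \<bullet> (x' - x) \<le> norm (e - g x) * norm (x' - x)"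
      by (metis norm_cauchy_schwarz norm_minus_commute)
    moreover have "0 \<le> (norm (e - g x) - \<beta> * norm (x' - x))\<^sup>2 / (2 * \<beta>)" using \<beta> by simp
    moreover have "(norm (e - g x) - \<beta> * norm (x' - x))\<^sup>2 / (2 * \<beta>)
       = (norm (e - g x))\<^sup>2 / (2 * \<beta>) + \<beta> / 2 * (norm (x' - x))\<^sup>2 - norm (e - g x) * norm (x' - x)"
      using \<beta> by (simp add: power2_eq_square field_simps)
    ultimately show ?thesis by linarith
  qed
  have 3: "g x \<bullet> (x' - x) = (g x - e) \<bullet> (x' - x) + \<omega> * (e \<bullet> (y' - y))"
    by (simp add: d inner_diff_left algebra_simps)
  \<comment> \<open>Since \<open>\<beta> + \<Lambda> = 1 / \<eta>\<close>, the two quadratic terms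
    add up to the one that the proximal step provides.\<close>
  have 4: "\<beta> / 2 * (norm (x' - x))\<^sup>2 + \<Lambda> / 2 * (norm (x' - x))\<^sup>2
      = \<omega>\<^sup>2 / (2 * \<eta>) * (norm (y' - y))\<^sup>2"
    unfolding d norm_scaleR power_mult_distrib by (simp add: \<beta>_def field_simps)
  have "\<omega> * (e \<bullet> (y' - y) + \<omega> / (2 * \<eta>) * (norm (y' - y))\<^sup>2 + reg Q y'
          + \<omega> / (2 * \<eta>) * (norm (u - y'))\<^sup>2)
        \<le> \<omega> * (e \<bullet> (u - y) + \<omega> / (2 * \<eta>) * (norm (u - y))\<^sup>2 + reg Q u)"
    unfolding e_def y'_def using params by (intro mult_left_mono next_y(2)[OF y u]) simp
  then have 5: "\<omega> * (e \<bullet> (y' - y)) + \<omega>\<^sup>2 / (2 * \<eta>) * (norm (y' - y))\<^sup>2 + \<omega> * reg Q y'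
          + \<omega>\<^sup>2 / (2 * \<eta>) * (norm (u - y'))\<^sup>2
        \<le> \<omega> * (e \<bullet> (u - y)) + \<omega>\<^sup>2 / (2 * \<eta>) * (norm (u - y))\<^sup>2 + \<omega> * reg Q u"
    by (simp add: distrib_left power2_eq_square mult.assoc)
  have "x' = (1 - \<omega>) *\<^sub>R z + \<omega> *\<^sub>R y'" by (simp add: x'_def algebra_simps)
  then have 6: "reg Q x' \<le> (1 - \<omega>) * reg Q z + \<omega> * reg Q y'"
    using convex_onD[OF convex_reg, of \<omega> z y'] params momentum_less_1 z y' by simp
  show ?thesis
    unfolding objective_eq x'_def[symmetric] e_def[symmetric] using 1 2 3 4 5 6 by linarith
qed

lemma step_drift:
  fixes z y u :: rvec
  defines "x \<equiv> z + \<omega> *\<^sub>R (y - z)"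
  assumes z: "z \<in> X" and y: "y \<in> X" and u: "u \<in> X"
  shows "(\<Sum>i<n. p i * (F (z + \<omega> *\<^sub>R (next_y z x y i - z))
      + \<omega>\<^sup>2 / (2 * \<eta>) * (norm (u - next_y z x y i))\<^sup>2))
    \<le> (1 - \<omega>) * F z + \<omega> * F u + \<omega>\<^sup>2 / (2 * \<eta>) * (norm (u - y))\<^sup>2"
proof -
  define \<beta> where "\<beta> = 1 / \<eta> - \<Lambda>"
  define c where "c = smooth_part x + (1 - \<omega>) * reg Q z + \<omega> * reg Q u
      + \<omega>\<^sup>2 / (2 * \<eta>) * (norm (u - y))\<^sup>2"
  define D where "D = smooth_part z - smooth_part x - g x \<bullet> (z - x)"
  have x: "x \<in> X" using y z by (simp add: x_def)
  have \<beta>: "0 < \<beta>" using params by (simp add: \<beta>_def field_simps)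
  have D: "0 \<le> D" using smooth_part_above_tangent[OF x z] by (simp add: D_def)
  have "(\<Sum>i<n. p i * (F (z + \<omega> *\<^sub>R (next_y z x y i - z))
      + \<omega>\<^sup>2 / (2 * \<eta>) * (norm (u - next_y z x y i))\<^sup>2))
    \<le> (\<Sum>i<n. p i * (c + \<omega> * (estimator z x i \<bullet> (u - y)) + (norm (estimator z x i - g x))\<^sup>2 / (2 * \<beta>)))"
    using step_descent[OF z y u] unfolding x_def[symmetric] \<beta>_def[symmetric]
    by (intro sum_mono mult_left_mono) (auto simp: c_def algebra_simps)
  also have "\<dots> = (\<Sum>i<n. p i) * c + \<omega> * (\<Sum>i<n. p i * (estimator z x i \<bullet> (u - y)))
      + (\<Sum>i<n. p i * (norm (estimator z x i - g x))\<^sup>2) / (2 * \<beta>)"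
    by (simp add: distrib_left sum.distrib sum_distrib_right sum_distrib_left sum_divide_distrib mult_ac)
  also have "\<dots> \<le> c + \<omega> * (g x \<bullet> (u - y)) + 2 * \<Lambda> * D / (2 * \<beta>)"
    unfolding sum_p estimator_unbiased D_def using \<beta>
    by (intro add_mono divide_right_mono estimator_variance[OF x z]) auto
  \<comment> \<open>The factor of the variance is the ratio that the admissible momentum keeps below
    \<open>1 - \<omega>\<close>.\<close>
  also have "2 * \<Lambda> * D / (2 * \<beta>) = \<Lambda> * \<eta> / (1 - \<Lambda> * \<eta>) * D"
    using params by (simp add: \<beta>_def field_simps)
  also have "\<dots> \<le> (1 - \<omega>) * D" using params(4) D by (rule mult_right_mono)
  also have "c + \<omega> * (g x \<bullet> (u - y)) + (1 - \<omega>) * D = \<omega> * (smooth_part x + g x \<bullet> (u - x))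
      + (1 - \<omega>) * F z + \<omega> * reg Q u + \<omega>\<^sup>2 / (2 * \<eta>) * (norm (u - y))\<^sup>2"
  proof -
    \<comment> \<open>This uses \<open>x = (1 - \<omega>) z + \<omega> y\<close>. The part along
      \<open>z - x\<close> cancels the linear term of \<open>(1 - \<omega>) * D\<close>.\<close>
    have "\<omega> *\<^sub>R (u - y) = \<omega> *\<^sub>R (u - x) + (1 - \<omega>) *\<^sub>R (z - x)" by (simp add: x_def algebra_simps)
    then have "g x \<bullet> (\<omega> *\<^sub>R (u - y)) = g x \<bullet> (\<omega> *\<^sub>R (u - x) + (1 - \<omega>) *\<^sub>R (z - x))" by simp
    then have "\<omega> * (g x \<bullet> (u - y)) = \<omega> * (g x \<bullet> (u - x)) + (1 - \<omega>) * (g x \<bullet> (z - x))"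
      by (simp only: inner_add_right inner_scaleR_right)
    then show ?thesis by (simp add: c_def D_def objective_eq algebra_simps)
  qed
  also have "\<omega> * (smooth_part x + g x \<bullet> (u - x)) \<le> \<omega> * smooth_part u"
    using params by (intro mult_left_mono smooth_part_above_tangent[OF x u]) simp
  finally show ?thesis by (simp add: objective_eq algebra_simps)
qed

end

section \<open>Epochs\<close>

text \<open>Jensen's inequality one summand at a time, so that \<open>t * f (average)\<close> can
  serve as a potential along a chain that stores only the running sum. At \<open>t = 0\<close> the
  quotient is a division by zero, but its value is multiplied by 0.\<close>

lemma convex_running_sum:
  assumes "convex_on (Rd d) f" "a \<in> Rd d" "x \<in> Rd d" "t = 0 \<Longrightarrow> a = 0"
  shows "real (Suc t) * f ((a + x) /\<^sub>R real (Suc t)) \<le> real t * f (a /\<^sub>R real t) + f x"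
proof (cases "t = 0")
  case True
  then show ?thesis using assms(4) by simp
next
  case False
  define r where "r = 1 / real (Suc t)"
  have r: "0 \<le> r" "r \<le> 1" "real (Suc t) * (1 - r) = real t" "real (Suc t) * r = 1"
    by (auto simp: r_def field_simps)
  have c: "(1 - r) * inverse (real t) = inverse (real (Suc t))" "r = inverse (real (Suc t))"
    using False by (auto simp: r_def field_simps)
  have "(1 - r) *\<^sub>R (a /\<^sub>R real t) + r *\<^sub>R x = (a + x) /\<^sub>R real (Suc t)"
    unfolding scaleR_scaleR c(1) scaleR_add_right by (simp only: c(2))
  with convex_onD[OF assms(1) r(1,2), of "a /\<^sub>R real t" x] assms(2,3)
  have "f ((a + x) /\<^sub>R real (Suc t)) \<le> (1 - r) * f (a /\<^sub>R real t) + r * f x" by simp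
  then have "real (Suc t) * f ((a + x) /\<^sub>R real (Suc t))
      \<le> real (Suc t) * ((1 - r) * f (a /\<^sub>R real t) + r * f x)" by (intro mult_left_mono) auto
  also have "\<dots> = real t * f (a /\<^sub>R real t) + f x"
    unfolding distrib_left mult.assoc[symmetric] r(3,4) by simp
  finally show ?thesis .
qed

context asvrg_run
begin

abbreviation "\<kappa> \<equiv> \<omega>\<^sup>2 / (2 * \<eta>)"

text \<open>The one-step bound summed over an epoch; the average of the \<open>x\<close>-iterates is
  the next snapshot.\<close>

lemma inner_loop:
  fixes z x y u :: rvec and c :: nat
  defines "M \<equiv> iterate_pmf m (asvrg_step Q A z) (x, y, 0, c)"
  assumes z: "z \<in> X" and y: "y \<in> X" and u: "u \<in> X" and x: "x = z + \<omega> *\<^sub>R (y - z)"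
  shows "finite (set_pmf M)"
    and "\<And>x' y' a c'. (x', y', a, c') \<in> set_pmf M \<Longrightarrow> y' \<in> X \<and> a \<in> X \<and> c' = c + 2 * m"
    and "measure_pmf.expectation M (\<lambda>(x', y', a, c'). real m * F (a /\<^sub>R real m) + \<kappa> * (norm (u - y'))\<^sup>2)
      \<le> \<kappa> * (norm (u - y))\<^sup>2 + real m * ((1 - \<omega>) * F z + \<omega> * F u)"
proof -
  \<comment> \<open>The one-step bound needs \<open>x'\<close> tied to \<open>y'\<close>, and the
    running average needs an empty sum at \<open>t = 0\<close>. The counter is deterministic, so
    cost bounds hold surely and not just in expectation.\<close>
  define I :: "nat \<Rightarrow> rvec \<times> rvec \<times> rvec \<times> nat \<Rightarrow> bool" where
    "I t = (\<lambda>(x', y', a, c'). x' = z + \<omega> *\<^sub>R (y' - z) \<and> y' \<in> X \<and> a \<in> X \<and> (t = 0 \<longrightarrow> a = 0)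
       \<and> c' = c + 2 * t)" for t
  define V :: "nat \<Rightarrow> rvec \<times> rvec \<times> rvec \<times> nat \<Rightarrow> real" where
    "V t = (\<lambda>(x', y', a, c'). real t * F (a /\<^sub>R real t) + \<kappa> * (norm (u - y'))\<^sup>2)" for t
  have init: "I 0 (x, y, 0, c)" using x y by (simp add: I_def)
  have fin: "finite (set_pmf (asvrg_step Q A z s))" for s
    by (cases s) (simp add: asvrg_step_eq)
  have inv: "I (Suc t) s'" if "I t s" "s' \<in> set_pmf (asvrg_step Q A z s)" for t s s'
    using that z by (cases s) (auto simp: I_def asvrg_step_eq Let_def next_y(1))
  have drift: "measure_pmf.expectation (asvrg_step Q A z s) (V (Suc t))
      \<le> V t s + ((1 - \<omega>) * F z + \<omega> * F u)" if "I t s" for t s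
  proof -
    obtain x' y' a c' where s: "s = (x', y', a, c')" by (cases s) auto
    with that have I: "x' = z + \<omega> *\<^sub>R (y' - z)" "y' \<in> X" "a \<in> X" "t = 0 \<Longrightarrow> a = 0"
      by (auto simp: I_def)
    define w where "w i = next_y z x' y' i" for i
    have w: "w i \<in> X" for i using I(2) by (simp add: w_def next_y(1))
    have "measure_pmf.expectation (asvrg_step Q A z s) (V (Suc t))
        = (\<Sum>i<n. p i * (real (Suc t) * F ((a + (z + \<omega> *\<^sub>R (w i - z))) /\<^sub>R real (Suc t))
            + \<kappa> * (norm (u - w i))\<^sup>2))"
      unfolding s asvrg_step_eq integral_map_pmf expectation_samp V_def Let_def w_def by simp
    also have "\<dots> \<le> (\<Sum>i<n. p i * ((real t * F (a /\<^sub>R real t) + F (z + \<omega> *\<^sub>R (w i - z)))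
            + \<kappa> * (norm (u - w i))\<^sup>2))"
      using z w I by (intro sum_mono mult_left_mono add_right_mono
          convex_running_sum[OF convex_objective]) auto
    also have "\<dots> = (\<Sum>i<n. p i) * (real t * F (a /\<^sub>R real t))
        + (\<Sum>i<n. p i * (F (z + \<omega> *\<^sub>R (w i - z)) + \<kappa> * (norm (u - w i))\<^sup>2))"
      unfolding sum_distrib_right sum.distrib[symmetric]
      by (intro sum.cong) (auto simp: algebra_simps)
    also have "\<dots> \<le> real t * F (a /\<^sub>R real t)
        + ((1 - \<omega>) * F z + \<omega> * F u + \<kappa> * (norm (u - y'))\<^sup>2)"
      using step_drift[OF z I(2) u] unfolding sum_p w_def I(1) by simp
    finally show ?thesis by (simp add: V_def s)
  qed
  have *: "finite (set_pmf M) \<and> (\<forall>s'\<in>set_pmf M. I m s')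
      \<and> measure_pmf.expectation M (V m) \<le> V 0 (x, y, 0, c) + real m * ((1 - \<omega>) * F z + \<omega> * F u)"
    unfolding M_def by (rule iterate_pmf_drift[where I = I, OF init]) (use fin inv drift in blast)
  show "finite (set_pmf M)" using * by blast
  show "y' \<in> X \<and> a \<in> X \<and> c' = c + 2 * m" if "(x', y', a, c') \<in> set_pmf M" for x' y' a c'
    using * that by (force simp: I_def)
  show "measure_pmf.expectation M (\<lambda>(x', y', a, c'). real m * F (a /\<^sub>R real m) + \<kappa> * (norm (u - y'))\<^sup>2)
      \<le> \<kappa> * (norm (u - y))\<^sup>2 + real m * ((1 - \<omega>) * F z + \<omega> * F u)"
    using * by (simp add: V_def)
qed

text \<open>The epoch bound divided by \<open>m\<close>, with the value at the new snapshot split in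
  two: the share \<open>\<omega>\<close> enters the running average of snapshots, and the share
  \<open>1 - \<omega>\<close> cancels against the start of the next epoch.\<close>

lemma epochs:
  fixes z u :: rvec and c S :: nat
  defines "M \<equiv> iterate_pmf S (asvrg_epoch Q A) (z, z, z, 0, c)"
  assumes z: "z \<in> X" and u: "u \<in> X"
  shows "finite (set_pmf M)"
    and "\<And>z' x' y' Z c'. (z', x', y', Z, c') \<in> set_pmf M \<Longrightarrow>
      z' \<in> X \<and> y' \<in> X \<and> Z \<in> X \<and> c' = c + S * (n + 2 * m)"
    and "measure_pmf.expectation M (\<lambda>(z', x', y', Z, c').
        \<omega> * (real S * F (Z /\<^sub>R real S)) + (1 - \<omega>) * F z' + \<kappa> / real m * (norm (u - y'))\<^sup>2)
      \<le> (1 - \<omega>) * F z + \<kappa> / real m * (norm (u - z))\<^sup>2 + real S * (\<omega> * F u)"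
proof -
  define I :: "nat \<Rightarrow> rvec \<times> rvec \<times> rvec \<times> rvec \<times> nat \<Rightarrow> bool" where
    "I s = (\<lambda>(z', x', y', Z, c'). z' \<in> X \<and> x' = z' + \<omega> *\<^sub>R (y' - z') \<and> y' \<in> X \<and> Z \<in> X
       \<and> (s = 0 \<longrightarrow> Z = 0) \<and> c' = c + s * (n + 2 * m))" for s
  define V :: "nat \<Rightarrow> rvec \<times> rvec \<times> rvec \<times> rvec \<times> nat \<Rightarrow> real" where
    "V s = (\<lambda>(z', x', y', Z, c'). \<omega> * (real s * F (Z /\<^sub>R real s)) + (1 - \<omega>) * F z'
       + \<kappa> / real m * (norm (u - y'))\<^sup>2)" for s
  have init: "I 0 (z, z, z, 0, c)" using z by (simp add: I_def)
  have *: "finite (set_pmf (asvrg_epoch Q A \<sigma>)) \<and> (\<forall>\<sigma>'\<in>set_pmf (asvrg_epoch Q A \<sigma>). I (Suc s) \<sigma>')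
      \<and> measure_pmf.expectation (asvrg_epoch Q A \<sigma>) (V (Suc s)) \<le> V s \<sigma> + \<omega> * F u"
    if "I s \<sigma>" for s \<sigma>
  proof -
    obtain z' x' y' Z c' where \<sigma>: "\<sigma> = (z', x', y', Z, c')" by (cases \<sigma>) auto
    with that have I: "z' \<in> X" "x' = z' + \<omega> *\<^sub>R (y' - z')" "y' \<in> X" "Z \<in> X" "s = 0 \<Longrightarrow> Z = 0"
      "c' = c + s * (n + 2 * m)" by (auto simp: I_def)
    define N where "N = iterate_pmf m (asvrg_step Q A z') (x', y', 0, c' + n)"
    note inner = inner_loop[OF I(1,3) u I(2), where c = "c' + n", folded N_def]
    define T :: "rvec \<times> rvec \<times> rvec \<times> nat \<Rightarrow> rvec \<times> rvec \<times> rvec \<times> rvec \<times> nat" where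
      "T = (\<lambda>(x'', y'', a, c'').
       let z'' = a /\<^sub>R real m
       in (z'', (1 - \<omega>) *\<^sub>R z'' + \<omega> *\<^sub>R y'', y'', Z + z'', c''))"
    have epoch: "asvrg_epoch Q A \<sigma> = map_pmf T N"
      by (simp add: asvrg_epoch_def \<sigma> N_def T_def)
    have "I (Suc s) (T q)" if "q \<in> set_pmf N" for q
      using inner(2)[of "fst q" "fst (snd q)" "fst (snd (snd q))" "snd (snd (snd q))"] that I
      by (auto simp: I_def T_def Let_def split_beta algebra_simps)
    then have inv: "\<forall>\<sigma>'\<in>set_pmf (asvrg_epoch Q A \<sigma>). I (Suc s) \<sigma>'" by (auto simp: epoch)
    define h :: "rvec \<times> rvec \<times> rvec \<times> nat \<Rightarrow> real" where "h = (\<lambda>(x'', y'', a, c'').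
      real m * F (a /\<^sub>R real m) + \<kappa> * (norm (u - y''))\<^sup>2)"
    have "measure_pmf.expectation (asvrg_epoch Q A \<sigma>) (V (Suc s))
        = measure_pmf.expectation N (\<lambda>q. V (Suc s) (T q))" by (simp add: epoch)
    also have "\<dots> \<le> measure_pmf.expectation N (\<lambda>q. 1 / real m * h q + \<omega> * (real s * F (Z /\<^sub>R real s)))"
    proof (rule expectation_mono_finite[OF inner(1)])
      fix q assume q: "q \<in> set_pmf N"
      obtain x'' y'' a c'' where q_eq: "q = (x'', y'', a, c'')" by (cases q) auto
      have a: "a /\<^sub>R real m \<in> X" using inner(2) q by (auto simp: q_eq)
      have "\<omega> * (real (Suc s) * F ((Z + a /\<^sub>R real m) /\<^sub>R real (Suc s)))
          \<le> \<omega> * (real s * F (Z /\<^sub>R real s) + F (a /\<^sub>R real m))"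
        using params I(5) by (intro mult_left_mono convex_running_sum[OF convex_objective I(4) a]) auto
      moreover have "1 / real m * h q = F (a /\<^sub>R real m) + \<kappa> / real m * (norm (u - y''))\<^sup>2"
        using params(5) by (simp add: h_def q_eq field_simps)
      ultimately show "V (Suc s) (T q) \<le> 1 / real m * h q + \<omega> * (real s * F (Z /\<^sub>R real s))"
        by (simp only: q_eq T_def V_def Let_def split) (simp add: algebra_simps)
    qed
    also have "\<dots> = 1 / real m * measure_pmf.expectation N h + \<omega> * (real s * F (Z /\<^sub>R real s))"
      by (rule expectation_affine_finite[OF inner(1)])
    also have "\<dots> \<le> 1 / real m * (\<kappa> * (norm (u - y'))\<^sup>2 + real m * ((1 - \<omega>) * F z' + \<omega> * F u))
        + \<omega> * (real s * F (Z /\<^sub>R real s))"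
      unfolding h_def by (intro add_right_mono mult_left_mono inner(3)) simp
    also have "\<dots> = V s \<sigma> + \<omega> * F u"
      using params(5) by (simp add: V_def \<sigma> distrib_left)
    finally show ?thesis using inv inner(1) by (simp add: epoch)
  qed
  have **: "finite (set_pmf M) \<and> (\<forall>s'\<in>set_pmf M. I S s')
      \<and> measure_pmf.expectation M (V S) \<le> V 0 (z, z, z, 0, c) + real S * (\<omega> * F u)"
    unfolding M_def by (rule iterate_pmf_drift[where I = I, OF init]) (rule *)
  show "finite (set_pmf M)" using ** by blast
  show "z' \<in> X \<and> y' \<in> X \<and> Z \<in> X \<and> c' = c + S * (n + 2 * m)"
    if "(z', x', y', Z, c') \<in> set_pmf M" for z' x' y' Z c'
    using ** that by (force simp: I_def)
  show "measure_pmf.expectation M (\<lambda>(z', x', y', Z, c').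
        \<omega> * (real S * F (Z /\<^sub>R real S)) + (1 - \<omega>) * F z' + \<kappa> / real m * (norm (u - y'))\<^sup>2)
      \<le> (1 - \<omega>) * F z + \<kappa> / real m * (norm (u - z))\<^sup>2 + real S * (\<omega> * F u)"
    using ** by (simp add: V_def)
qed

end

section \<open>Restarts\<close>

lemma gap_eq:
  assumes "u \<in> Rd (vdim Q)" "\<And>w. w \<in> Rd (vdim Q) \<Longrightarrow> objective Q u \<le> objective Q w"
  shows "gap Q x = objective Q x - objective Q u"
proof -
  have "(INF w\<in>Rd (vdim Q). objective Q w) = objective Q u"
    by (rule cInf_eq_minimum) (use assms in auto)
  then show ?thesis by (simp add: gap_def)
qed

text \<open>The counter never influences the points. This matters because \<open>quartered\<close>
  starts from counter 0, whereas a later round starts from the accumulated count.\<close>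

lemma asvrg_step_shift:
  "asvrg_step Q A z (x, y, a, c + d) = map_pmf (\<lambda>(x, y, a, c). (x, y, a, c + d)) (asvrg_step Q A z (x, y, a, c))"
  by (simp add: asvrg_step_def Let_def map_pmf_comp)

lemma asvrg_epoch_shift:
  "asvrg_epoch Q A (z, x, y, Z, c + d)
    = map_pmf (\<lambda>(z, x, y, Z, c). (z, x, y, Z, c + d)) (asvrg_epoch Q A (z, x, y, Z, c))"
proof -
  have "iterate_pmf k (asvrg_step Q A z) ((\<lambda>(x, y, a, c). (x, y, a, c + d)) (x, y, 0, c + size_n Q))
    = map_pmf (\<lambda>(x, y, a, c). (x, y, a, c + d)) (iterate_pmf k (asvrg_step Q A z) (x, y, 0, c + size_n Q))"
    for k by (rule iterate_pmf_map) (auto simp: asvrg_step_shift)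
  then have "iterate_pmf k (asvrg_step Q A z) (x, y, 0, c + d + size_n Q)
    = map_pmf (\<lambda>(x, y, a, c). (x, y, a, c + d)) (iterate_pmf k (asvrg_step Q A z) (x, y, 0, c + size_n Q))"
    for k by (simp add: ac_simps)
  then show ?thesis
    by (simp add: asvrg_epoch_def map_pmf_comp split_beta Let_def)
qed

lemma asvrg_block_shift:
  "asvrg_block Q \<mu> A (z, c + d) = map_pmf (\<lambda>(z, c). (z, c + d)) (asvrg_block Q \<mu> A (z, c))"
proof -
  have "iterate_pmf k (asvrg_epoch Q A) ((\<lambda>(z, x, y, Z, c). (z, x, y, Z, c + d)) (z, z, z, 0, c))
    = map_pmf (\<lambda>(z, x, y, Z, c). (z, x, y, Z, c + d)) (iterate_pmf k (asvrg_epoch Q A) (z, z, z, 0, c))"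
    for k by (rule iterate_pmf_map) (auto simp: asvrg_epoch_shift)
  then show ?thesis
    by (simp add: asvrg_block_def map_pmf_comp split_beta)
qed

lemma asvrg_shift:
  "asvrg Q \<mu> A k (z, c + d) = map_pmf (\<lambda>(z, c). (z, c + d)) (asvrg Q \<mu> A k (z, c))"
  using iterate_pmf_map[of "asvrg_block Q \<mu> A" "\<lambda>(z, c). (z, c + d)" k "(z, c)"]
  by (simp add: asvrg_def asvrg_block_shift split_beta)

text \<open>Strong convexity enters only as quadratic growth at the minimizer
  \<open>u\<close>.\<close>

locale asvrg_strongly_convex = asvrg_run +
  fixes \<mu> :: real and u :: rvec
  assumes \<mu>: "0 < \<mu>" and u: "u \<in> X"
    and growth: "\<And>w. w \<in> X \<Longrightarrow> objective Q u + \<mu> / 2 * (norm (w - u))\<^sup>2 \<le> objective Q w"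
begin

abbreviation "S \<equiv> restart_len \<mu> A"

lemma min_u: "w \<in> X \<Longrightarrow> F u \<le> F w"
  using growth[of w] \<mu> by (smt (verit) divide_nonneg_pos mult_nonneg_nonneg zero_le_power2)

lemma gap_F: "gap Q x = F x - F u"
  by (rule gap_eq[OF u min_u])

lemma restart_len_ge: "(1 - \<omega>) / \<omega> + \<omega> / (\<eta> * real m * \<mu>) \<le> real S / 2"
proof -
  have "t \<le> real (nat \<lceil>2 * t\<rceil>) / 2" for t :: real by linarith
  then show ?thesis unfolding restart_len_def .
qed

lemma restart_len_pos: "0 < S"
proof -
  have "0 < \<omega> / (\<eta> * real m * \<mu>)" "0 \<le> (1 - \<omega>) / \<omega>"
    using params \<mu> momentum_less_1 by auto
  then have "0 < (1 - \<omega>) / \<omega> + \<omega> / (\<eta> * real m * \<mu>)" by (intro add_nonneg_pos)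
  then have "0 < real S / 2" using restart_len_ge by (rule less_le_trans)
  then show ?thesis by simp
qed

text \<open>The epoch bound with \<open>u\<close> as comparison point: the initial terms are a
  multiple of the gap at \<open>z\<close>, and the restart length makes them at most half of
  \<open>\<omega> * S\<close> times that gap.\<close>

lemma block:
  assumes z: "z \<in> X"
  shows "finite (set_pmf (asvrg_block Q \<mu> A (z, c)))"
    and "\<And>x c'. (x, c') \<in> set_pmf (asvrg_block Q \<mu> A (z, c)) \<Longrightarrow> x \<in> X \<and> c' = c + S * (n + 2 * m)"
    and "measure_pmf.expectation (asvrg_block Q \<mu> A (z, c)) (\<lambda>(x, _). gap Q x) \<le> gap Q z / 2"
proof -
  define M where "M = iterate_pmf S (asvrg_epoch Q A) (z, z, z, 0, c)"
  define T :: "rvec \<times> rvec \<times> rvec \<times> rvec \<times> nat \<Rightarrow> rvec \<times> nat" where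
    "T = (\<lambda>(_, _, _, Z, c'). (Z /\<^sub>R real S, c'))"
  note ep = epochs[OF z u, where S = S and c = c, folded M_def]
  have block: "asvrg_block Q \<mu> A (z, c) = map_pmf T M"
    by (simp add: asvrg_block_def M_def T_def)
  show "finite (set_pmf (asvrg_block Q \<mu> A (z, c)))" using ep(1) by (simp add: block)
  show "x \<in> X \<and> c' = c + S * (n + 2 * m)"
    if xc: "(x, c') \<in> set_pmf (asvrg_block Q \<mu> A (z, c))" for x c'
  proof -
    from xc obtain q where q: "q \<in> set_pmf M" "T q = (x, c')" by (auto simp: block)
    obtain z' x' y' Z c'' where "q = (z', x', y', Z, c'')" by (cases q) auto
    with ep(2)[of z' x' y' Z c''] q show ?thesis by (auto simp: T_def)
  qed
  have S: "0 < real S" using restart_len_pos by simp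
  define E where "E = measure_pmf.expectation M (\<lambda>q. gap Q (fst (T q)))"
  have "\<omega> * real S * E + (\<omega> * real S * F u + (1 - \<omega>) * F u)
      = measure_pmf.expectation M (\<lambda>q. \<omega> * real S * gap Q (fst (T q)) + (\<omega> * real S * F u + (1 - \<omega>) * F u))"
    unfolding E_def by (rule expectation_affine_finite[OF ep(1), symmetric])
  also have "\<dots> \<le> measure_pmf.expectation M (\<lambda>(z', x', y', Z, c').
        \<omega> * (real S * F (Z /\<^sub>R real S)) + (1 - \<omega>) * F z' + \<kappa> / real m * (norm (u - y'))\<^sup>2)"
  proof (rule expectation_mono_finite[OF ep(1)])
    fix q assume q: "q \<in> set_pmf M"
    obtain z' x' y' Z c'' where q_eq: "q = (z', x', y', Z, c'')" by (cases q) auto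
    have "z' \<in> X" using ep(2) q by (auto simp: q_eq)
    \<comment> \<open>At the last epoch the snapshot value is replaced by the minimum and the
      squared distance by 0.\<close>
    then have "(1 - \<omega>) * F u \<le> (1 - \<omega>) * F z'"
      using momentum_less_1 by (intro mult_left_mono min_u) auto
    moreover have "0 \<le> \<kappa> / real m * (norm (u - y'))\<^sup>2" using params by simp
    ultimately show "\<omega> * real S * gap Q (fst (T q)) + (\<omega> * real S * F u + (1 - \<omega>) * F u)
        \<le> (case q of (z', x', y', Z, c') \<Rightarrow>
          \<omega> * (real S * F (Z /\<^sub>R real S)) + (1 - \<omega>) * F z' + \<kappa> / real m * (norm (u - y'))\<^sup>2)"
      by (simp add: q_eq T_def gap_F right_diff_distrib)
  qed
  also have "\<dots> \<le> (1 - \<omega>) * F z + \<kappa> / real m * (norm (u - z))\<^sup>2 + real S * (\<omega> * F u)"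
    by (rule ep(3))
  finally have 1: "\<omega> * real S * E \<le> (1 - \<omega>) * gap Q z + \<kappa> / real m * (norm (u - z))\<^sup>2"
    by (simp add: gap_F algebra_simps)
  \<comment> \<open>Growth at \<open>u\<close> converts the initial distance into the initial
    gap.\<close>
  have "(norm (u - z))\<^sup>2 \<le> 2 / \<mu> * gap Q z"
    using growth[OF z] \<mu> by (simp add: gap_F norm_minus_commute field_simps)
  then have "\<kappa> / real m * (norm (u - z))\<^sup>2 \<le> \<kappa> / real m * (2 / \<mu> * gap Q z)"
    using params by (intro mult_left_mono) auto
  with 1 have "\<omega> * real S * E \<le> (1 - \<omega>) * gap Q z + \<kappa> / real m * (2 / \<mu> * gap Q z)" by linarith
  also have "\<dots> = \<omega> * (((1 - \<omega>) / \<omega> + \<omega> / (\<eta> * real m * \<mu>)) * gap Q z)"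
    using params \<mu> by (simp add: field_simps power2_eq_square)
  also have "\<dots> \<le> \<omega> * ((real S / 2) * gap Q z)"
    using params(3) min_u[OF z] by (intro mult_left_mono mult_right_mono restart_len_ge) (auto simp: gap_F)
  finally have "(\<omega> * real S) * E \<le> (\<omega> * real S) * (gap Q z / 2)" by (simp add: mult_ac)
  then have "E \<le> gap Q z / 2" using S params by (subst (asm) mult_le_cancel_left_pos) auto
  then show "measure_pmf.expectation (asvrg_block Q \<mu> A (z, c)) (\<lambda>(x, _). gap Q x) \<le> gap Q z / 2"
    by (simp add: block E_def split_beta)
qed

lemma asvrg_blocks:
  assumes z: "z \<in> X"
  shows "finite (set_pmf (asvrg Q \<mu> A k (z, c)))"
    and "\<And>x c'. (x, c') \<in> set_pmf (asvrg Q \<mu> A k (z, c)) \<Longrightarrow> x \<in> X \<and> c' = c + k * (S * (n + 2 * m))"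
    and "measure_pmf.expectation (asvrg Q \<mu> A k (z, c)) (\<lambda>(x, _). gap Q x) \<le> gap Q z / 2 ^ k"
proof -
  define I :: "nat \<Rightarrow> rvec \<times> nat \<Rightarrow> bool" where
    "I k = (\<lambda>(x, c'). x \<in> X \<and> c' = c + k * (S * (n + 2 * m)))" for k
  \<comment> \<open>Scaling by \<open>2 ^ k\<close> turns halving at each restart into zero
    drift.\<close>
  define V :: "nat \<Rightarrow> rvec \<times> nat \<Rightarrow> real" where "V k = (\<lambda>(x, _). 2 ^ k * gap Q x)" for k
  have V: "V k = (\<lambda>q. 2 ^ k * gap Q (fst q) + 0)" for k by (auto simp: V_def)
  have step: "finite (set_pmf (asvrg_block Q \<mu> A q)) \<and> (\<forall>q'\<in>set_pmf (asvrg_block Q \<mu> A q). I (Suc k) q')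
      \<and> measure_pmf.expectation (asvrg_block Q \<mu> A q) (V (Suc k)) \<le> V k q + 0" if "I k q" for k q
  proof -
    obtain x c' where q: "q = (x, c')" by (cases q) auto
    have x: "x \<in> X" and c': "c' = c + k * (S * (n + 2 * m))" using that by (auto simp: I_def q)
    note b = block[OF x, where c = c', folded q]
    have "measure_pmf.expectation (asvrg_block Q \<mu> A q) (V (Suc k))
        = 2 ^ Suc k * measure_pmf.expectation (asvrg_block Q \<mu> A q) (\<lambda>(x, _). gap Q x) + 0"
      unfolding V by (subst expectation_affine_finite[OF b(1)]) (simp add: case_prod_beta')
    also have "\<dots> \<le> 2 ^ Suc k * (gap Q x / 2) + 0" by (intro add_right_mono mult_left_mono b(3)) simp
    finally have "measure_pmf.expectation (asvrg_block Q \<mu> A q) (V (Suc k)) \<le> V k q + 0"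
      by (simp add: V_def q)
    moreover have "\<forall>q'\<in>set_pmf (asvrg_block Q \<mu> A q). I (Suc k) q'"
      using b(2) by (fastforce simp: I_def c')
    ultimately show ?thesis using b(1) by blast
  qed
  have init: "I 0 (z, c)" using z by (simp add: I_def)
  have *: "finite (set_pmf (asvrg Q \<mu> A k (z, c))) \<and> (\<forall>q'\<in>set_pmf (asvrg Q \<mu> A k (z, c)). I k q')
      \<and> measure_pmf.expectation (asvrg Q \<mu> A k (z, c)) (V k) \<le> V 0 (z, c) + real k * 0"
    unfolding asvrg_def by (rule iterate_pmf_drift[where I = I, OF init]) (rule step)
  show fin: "finite (set_pmf (asvrg Q \<mu> A k (z, c)))" using * by blast
  show "x \<in> X \<and> c' = c + k * (S * (n + 2 * m))"
    if "(x, c') \<in> set_pmf (asvrg Q \<mu> A k (z, c))" for x c'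
    using * that by (force simp: I_def)
  have "measure_pmf.expectation (asvrg Q \<mu> A k (z, c)) (V k)
      = 2 ^ k * measure_pmf.expectation (asvrg Q \<mu> A k (z, c)) (\<lambda>(x, _). gap Q x) + 0"
    unfolding V by (subst expectation_affine_finite[OF fin]) (simp add: case_prod_beta')
  with * show "measure_pmf.expectation (asvrg Q \<mu> A k (z, c)) (\<lambda>(x, _). gap Q x) \<le> gap Q z / 2 ^ k"
    by (simp add: V_def field_simps)
qed

lemma quartered_2: "z \<in> X \<Longrightarrow> quartered Q \<mu> A z 2"
  using asvrg_blocks(3)[of z 2 0] by (simp add: quartered_def)

text \<open>Two restarts suffice, so the \<open>LEAST\<close> in the stopping rule exists and is at
  most 2; the shift lemma carries its guarantee from counter 0 to counter \<open>c\<close>.\<close>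

lemma until_quartered:
  assumes z: "z \<in> X"
  shows "finite (set_pmf (asvrg_until_quartered Q \<mu> A (z, c)))"
    and "\<And>x c'. (x, c') \<in> set_pmf (asvrg_until_quartered Q \<mu> A (z, c)) \<Longrightarrow>
      x \<in> X \<and> c' \<le> c + 2 * (S * (n + 2 * m))"
    and "measure_pmf.expectation (asvrg_until_quartered Q \<mu> A (z, c)) (\<lambda>(x, _). gap Q x) \<le> gap Q z / 4"
proof -
  define k where "k = (LEAST k. quartered Q \<mu> A z k)"
  have k: "quartered Q \<mu> A z k" "k \<le> 2"
    unfolding k_def using quartered_2[OF z] by (auto intro: LeastI Least_le)
  have eq: "asvrg_until_quartered Q \<mu> A (z, c) = asvrg Q \<mu> A k (z, c)"
    by (simp add: asvrg_until_quartered_def k_def)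
  show "finite (set_pmf (asvrg_until_quartered Q \<mu> A (z, c)))"
    unfolding eq by (rule asvrg_blocks(1)[OF z])
  show "x \<in> X \<and> c' \<le> c + 2 * (S * (n + 2 * m))"
    if "(x, c') \<in> set_pmf (asvrg_until_quartered Q \<mu> A (z, c))" for x c'
  proof -
    have "k * (S * (n + 2 * m)) \<le> 2 * (S * (n + 2 * m))" using k(2) by (rule mult_le_mono1)
    then show ?thesis using asvrg_blocks(2)[OF z that[unfolded eq]] by simp
  qed
  have "measure_pmf.expectation (asvrg Q \<mu> A k (z, c)) (\<lambda>(x, _). gap Q x)
      = measure_pmf.expectation (asvrg Q \<mu> A k (z, 0)) (\<lambda>(x, _). gap Q x)"
    using asvrg_shift[of Q \<mu> A k z 0 c] by (simp add: case_prod_beta')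
  then show "measure_pmf.expectation (asvrg_until_quartered Q \<mu> A (z, c)) (\<lambda>(x, _). gap Q x) \<le> gap Q z / 4"
    using k(1) by (simp add: eq quartered_def)
qed

end

section \<open>Adaptive regularization\<close>

lemma regularize_simps [simp]:
  "vdim (regularize Q x0 \<sigma>) = vdim Q" "size_n (regularize Q x0 \<sigma>) = size_n Q"
  "samp (regularize Q x0 \<sigma>) = samp Q" "Ltilde (regularize Q x0 \<sigma>) = Ltilde Q"
  "admissible_params (regularize Q x0 \<sigma>) A \<longleftrightarrow> admissible_params Q A"
  by (simp_all add: regularize_def Ltilde_def admissible_params_def)

lemma objective_regularize:
  "objective (regularize Q x0 \<sigma>) x = objective Q x + \<sigma> / 2 * (norm (x - x0))\<^sup>2"
  by (simp add: regularize_def objective_def)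

lemma finite_sum_problem_regularize:
  assumes Q: "finite_sum_problem Q" and \<sigma>: "0 \<le> \<sigma>"
  shows "finite_sum_problem (regularize Q x0 \<sigma>)"
proof -
  have cvx: "convex_on (Rd (vdim Q)) (reg Q)" using Q by (simp add: finite_sum_problem_def)
  have "convex_on (Rd (vdim Q)) (\<lambda>x. reg Q x + \<sigma> / 2 * (norm (x - x0))\<^sup>2)"
  proof (rule convex_onI)
    fix t :: real and x y assume t: "0 < t" "t < 1" and xy: "x \<in> Rd (vdim Q)" "y \<in> Rd (vdim Q)"
    have "0 \<le> \<sigma> / 2 * t * (1 - t) * (norm (y - x))\<^sup>2" using t \<sigma> by simp
    then show "reg Q ((1 - t) *\<^sub>R x + t *\<^sub>R y) + \<sigma> / 2 * (norm ((1 - t) *\<^sub>R x + t *\<^sub>R y - x0))\<^sup>2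
        \<le> (1 - t) * (reg Q x + \<sigma> / 2 * (norm (x - x0))\<^sup>2) + t * (reg Q y + \<sigma> / 2 * (norm (y - x0))\<^sup>2)"
      using convex_plus_quadratic_combination[OF cvx xy, of t \<sigma> x0] t by linarith
  qed simp
  then show ?thesis using Q by (simp add: finite_sum_problem_def regularize_def)
qed

lemma regularize_minimizer:
  assumes Q: "finite_sum_problem Q" and x0: "x0 \<in> Rd (vdim Q)" and \<sigma>: "0 < \<sigma>"
  obtains u where "u \<in> Rd (vdim Q)"
    "\<And>w. w \<in> Rd (vdim Q) \<Longrightarrow> objective (regularize Q x0 \<sigma>) u + \<sigma> / 2 * (norm (w - u))\<^sup>2
      \<le> objective (regularize Q x0 \<sigma>) w"
proof -
  interpret composite_problem Q by unfold_locales (rule Q)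
  obtain u where u: "u \<in> X" "\<And>v. v \<in> X \<Longrightarrow> objective Q u + \<sigma> / 2 * (norm (u - x0))\<^sup>2
      \<le> objective Q v + \<sigma> / 2 * (norm (v - x0))\<^sup>2"
    using convex_plus_quadratic_attains_min_Rd[OF convex_objective x0 \<sigma>] by blast
  show ?thesis
    by (rule that[OF u(1)])
      (use quadratic_growth_at_minimum[OF convex_objective u(1) _ u(2)] in \<open>simp add: objective_regularize\<close>)
qed

text \<open>With this step size \<open>\<Lambda> \<eta> / (1 - \<Lambda> \<eta>)\<close> is 1/3, so
  a momentum of at most 1/2 is admissible. The square root balances, up to a constant, the two terms
  of the restart length, and an epoch costs \<open>3 n\<close> evaluations.\<close>

definition round_params :: "finite_sum \<Rightarrow> real \<Rightarrow> asvrg_params" where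
  "round_params Q \<sigma> = \<lparr>stepsize = 1 / (4 * Ltilde Q),
     momentum = min (1 / 2) (sqrt (real (size_n Q) * \<sigma> / Ltilde Q)), epoch_len = size_n Q\<rparr>"

context composite_problem
begin

lemma round_params_admissible:
  assumes "0 < \<sigma>"
  shows "admissible_params Q (round_params Q \<sigma>)"
  using assms Ltilde_pos n_pos by (simp add: admissible_params_def round_params_def field_simps min_def)

text \<open>In terms of \<open>q\<close> the momentum is \<open>min (1/2) (1/q)\<close> and the
  restart length is at most \<open>3 + 10 q\<close>. Two blocks of epochs of cost \<open>3 n\<close>
  contribute the factor \<open>6 n\<close>.\<close>

lemma round_params_cost:
  assumes \<sigma>: "0 < \<sigma>"
  shows "real (2 * (restart_len \<sigma> (round_params Q \<sigma>) * (n + 2 * epoch_len (round_params Q \<sigma>))))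
    \<le> 18 * real n + 60 * sqrt (real n * \<Lambda> / \<sigma>)"
proof -
  define q where "q = sqrt (\<Lambda> / (real n * \<sigma>))"
  define w where "w = momentum (round_params Q \<sigma>)"
  have q: "0 < q" using Ltilde_pos n_pos \<sigma> by (simp add: q_def)
  have q2: "q\<^sup>2 = \<Lambda> / (real n * \<sigma>)" using Ltilde_pos \<sigma> by (simp add: q_def)
  have w: "w = min (1 / 2) (1 / q)"
    by (simp add: w_def round_params_def q_def real_sqrt_divide)
  have w_pos: "0 < w" using q by (simp add: w)
  have "1 / w \<le> 2 + q" using q by (simp add: w min_def)
  then have 1: "(1 - w) / w \<le> 1 + q" using w_pos by (simp add: diff_divide_distrib)
  have "w * q \<le> 1 / q * q" using q by (intro mult_right_mono) (auto simp: w)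
  then have "4 * (w * q) * q \<le> 4 * 1 * q" using q by (intro mult_right_mono mult_left_mono) auto
  moreover have "w / (stepsize (round_params Q \<sigma>) * real (epoch_len (round_params Q \<sigma>)) * \<sigma>) = 4 * w * q\<^sup>2"
    unfolding q2 by (simp add: round_params_def)
  ultimately have 2: "w / (stepsize (round_params Q \<sigma>) * real (epoch_len (round_params Q \<sigma>)) * \<sigma>) \<le> 4 * q"
    by (simp add: power2_eq_square mult.assoc)
  \<comment> \<open>Rounding up adds at most one, so \<open>1 + q + 4 q\<close> becomes
    \<open>3 + 10 q\<close>.\<close>
  have "real (nat \<lceil>2 * t\<rceil>) \<le> 2 * s + 1" if "t \<le> s" "0 \<le> s" for t s :: real
    using that by linarith
  from this[OF add_mono[OF 1 2]] q have S: "real (restart_len \<sigma> (round_params Q \<sigma>)) \<le> 3 + 10 * q"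
    unfolding restart_len_def w_def[symmetric] by simp
  have "real (2 * (restart_len \<sigma> (round_params Q \<sigma>) * (n + 2 * epoch_len (round_params Q \<sigma>))))
      = 6 * real n * real (restart_len \<sigma> (round_params Q \<sigma>))" by (simp add: round_params_def)
  also have "\<dots> \<le> 6 * real n * (3 + 10 * q)" using S by (intro mult_left_mono) auto
  also have "\<dots> = 18 * real n + 60 * (real n * q)" by (simp add: algebra_simps)
  also have "real n * q = sqrt ((real n)\<^sup>2 * (\<Lambda> / (real n * \<sigma>)))" by (subst real_sqrt_mult) (simp add: q_def)
  also have "(real n)\<^sup>2 * (\<Lambda> / (real n * \<sigma>)) = real n * \<Lambda> / \<sigma>"
    using n_pos by (simp add: power2_eq_square)
  finally show ?thesis .
qed

end

section \<open>Gap and cost over the rounds\<close>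

locale adaptive_regularization = composite_problem +
  fixes x0 xstar :: rvec and \<sigma>0 :: real
  assumes x0: "x0 \<in> X" and xstar: "xstar \<in> X"
    and xstar_min: "\<And>x. x \<in> X \<Longrightarrow> objective Q xstar \<le> objective Q x"
    and \<sigma>0: "0 < \<sigma>0"
begin

abbreviation "\<sigma> t \<equiv> \<sigma>0 / 2 ^ t"
abbreviation "A t \<equiv> round_params Q (\<sigma> t)"
abbreviation "Qr t \<equiv> regularize Q x0 (\<sigma> t)"
abbreviation "R \<equiv> norm (x0 - xstar)"
abbreviation "M t \<equiv> adapt_reg_asvrg Q x0 \<sigma>0 (\<lambda>t. round_params Q (\<sigma>0 / 2 ^ t)) t"
abbreviation "cost t \<equiv> 18 * real n + 60 * sqrt (real n * \<Lambda> / \<sigma> t)"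

lemma \<sigma>_pos: "0 < \<sigma> t"
  using \<sigma>0 by simp

lemma round_analysis: "\<exists>u. asvrg_strongly_convex (Qr t) (A t) (\<sigma> t) u"
proof -
  obtain u where "u \<in> X" "\<And>w. w \<in> X \<Longrightarrow> objective (Qr t) u + \<sigma> t / 2 * (norm (w - u))\<^sup>2 \<le> objective (Qr t) w"
    using regularize_minimizer[OF problem x0 \<sigma>_pos] by blast
  then have "asvrg_strongly_convex (Qr t) (A t) (\<sigma> t) u"
    using \<sigma>_pos[of t] round_params_admissible[OF \<sigma>_pos, of t]
      finite_sum_problem_regularize[OF problem, of "\<sigma> t" x0]
    by unfold_locales auto
  then show ?thesis ..
qed

lemma gap_regularized:
  obtains u where "u \<in> X" "\<And>w. w \<in> X \<Longrightarrow> objective (Qr t) u \<le> objective (Qr t) w"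
    "\<And>x. gap (Qr t) x = objective (Qr t) x - objective (Qr t) u"
proof -
  obtain u where "asvrg_strongly_convex (Qr t) (A t) (\<sigma> t) u" using round_analysis by blast
  then interpret r: asvrg_strongly_convex "Qr t" "A t" "\<sigma> t" u .
  show ?thesis using that[of u] r.u r.min_u r.gap_F by simp
qed

text \<open>Halving the regularization lowers the objective at every point, so the gap can grow only
  through the drop of the minimum. Testing the old problem at the new minimizer \<open>u\<close>
  bounds that drop by \<open>s / 2 * |u - x0|^2\<close>.\<close>

lemma gap_Suc_le: "gap (Qr (Suc t)) x \<le> gap (Qr t) x + \<sigma> (Suc t) / 2 * R\<^sup>2"
proof -
  obtain u where u: "u \<in> X" "\<And>w. w \<in> X \<Longrightarrow> objective (Qr (Suc t)) u \<le> objective (Qr (Suc t)) w"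
    "\<And>x. gap (Qr (Suc t)) x = objective (Qr (Suc t)) x - objective (Qr (Suc t)) u"
    using gap_regularized[of "Suc t"] by metis
  obtain v where v: "v \<in> X" "\<And>w. w \<in> X \<Longrightarrow> objective (Qr t) v \<le> objective (Qr t) w"
    "\<And>x. gap (Qr t) x = objective (Qr t) x - objective (Qr t) v"
    using gap_regularized[of t] by metis
  define s where "s = \<sigma> (Suc t)"
  have s: "0 < s" "\<sigma> t = 2 * s" using \<sigma>_pos[of "Suc t"] by (auto simp: s_def)
  \<comment> \<open>A regularized minimizer is no farther from \<open>x0\<close> than
    \<open>xstar\<close> is, since \<open>xstar\<close> has the smaller unregularized value.\<close>
  have "s / 2 * (norm (u - x0))\<^sup>2 \<le> s / 2 * R\<^sup>2"
    using u(2)[OF xstar] xstar_min[OF u(1)]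
    unfolding objective_regularize s_def[symmetric] norm_minus_commute[of xstar] by linarith
  moreover have "objective Q v + s * (norm (v - x0))\<^sup>2 \<le> objective Q u + s * (norm (u - x0))\<^sup>2"
    using v(2)[OF u(1)] unfolding objective_regularize s(2) by simp
  moreover have "0 \<le> s / 2 * (norm (x - x0))\<^sup>2" using s(1) by simp
  ultimately show ?thesis
    using u(3)[of x] v(3)[of x] unfolding objective_regularize s_def[symmetric] s(2) by simp
qed

text \<open>The form of the gap bound is stable under a round: quartering leaves
  \<open>\<sigma> t / 4 = \<sigma> (Suc t) / 2\<close>, and passing to the next regularizer adds
  another \<open>\<sigma> (Suc t) / 2\<close>.\<close>

lemma rounds_analysis:
  "finite (set_pmf (M t)) \<and> (\<forall>(x, c)\<in>set_pmf (M t). x \<in> X \<and> real c \<le> (\<Sum>i<t. cost i))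
    \<and> measure_pmf.expectation (M t) (\<lambda>q. gap (Qr t) (fst q))
      \<le> (objective Q x0 - objective Q xstar) / 4 ^ t + \<sigma> t * R\<^sup>2"
proof (induction t)
  case 0
  obtain u where u: "u \<in> X" "\<And>x. gap (Qr 0) x = objective (Qr 0) x - objective (Qr 0) u"
    using gap_regularized[of 0] by metis
  have "0 \<le> \<sigma>0 / 2 * (norm (u - x0))\<^sup>2" "0 \<le> \<sigma>0 * R\<^sup>2" using \<sigma>0 by auto
  then have "gap (Qr 0) x0 \<le> objective Q x0 - objective Q xstar + \<sigma>0 * R\<^sup>2"
    using xstar_min[OF u(1)] unfolding u(2) objective_regularize by simp
  then show ?case using x0 by simp
next
  case (Suc t)
  define K where "K = asvrg_until_quartered (Qr t) (\<sigma> t) (A t)"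
  define D where "D = (objective Q x0 - objective Q xstar) / 4 ^ t"
  obtain u where "asvrg_strongly_convex (Qr t) (A t) (\<sigma> t) u" using round_analysis by blast
  then interpret r: asvrg_strongly_convex "Qr t" "A t" "\<sigma> t" u .
  have K: "finite (set_pmf (K q))"
      "\<And>q'. q' \<in> set_pmf (K q) \<Longrightarrow> fst q' \<in> X \<and> real (snd q') \<le> real (snd q) + cost t"
      "measure_pmf.expectation (K q) (\<lambda>q. gap (Qr t) (fst q)) \<le> gap (Qr t) (fst q) / 4"
    if "q \<in> set_pmf (M t)" for q
  proof -
    obtain z c where q: "q = (z, c)" by (cases q)
    then have z: "z \<in> Rd (vdim (Qr t))" using Suc that by auto
    note b = r.until_quartered[OF z, where c = c, folded K_def q]
    show "finite (set_pmf (K q))" by (rule b(1))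
    show "measure_pmf.expectation (K q) (\<lambda>q. gap (Qr t) (fst q)) \<le> gap (Qr t) (fst q) / 4"
      using b(3) by (simp add: q case_prod_beta')
    fix q' assume "q' \<in> set_pmf (K q)"
    then have "fst q' \<in> X \<and> snd q' \<le> c + 2 * (restart_len (\<sigma> t) (A t) * (n + 2 * epoch_len (A t)))"
      using b(2)[of "fst q'" "snd q'"] by simp
    moreover from this have "real (snd q')
        \<le> real c + real (2 * (restart_len (\<sigma> t) (A t) * (n + 2 * epoch_len (A t))))"
      unfolding of_nat_add[symmetric] of_nat_le_iff by blast
    ultimately show "fst q' \<in> X \<and> real (snd q') \<le> real (snd q) + cost t"
      using round_params_cost[OF \<sigma>_pos, of t] unfolding q snd_conv by linarith
  qed
  have M: "M (Suc t) = bind_pmf (M t) K" by (simp add: K_def)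
  have fin: "finite (set_pmf (M t))" using Suc by blast
  have finS: "finite (set_pmf (M (Suc t)))" unfolding M using fin K(1) by simp
  have "x \<in> X \<and> real c \<le> (\<Sum>i<Suc t. cost i)" if "(x, c) \<in> set_pmf (M (Suc t))" for x c
  proof -
    from that obtain q where q: "q \<in> set_pmf (M t)" "(x, c) \<in> set_pmf (K q)" unfolding M by auto
    have "real (snd q) \<le> (\<Sum>i<t. cost i)" using Suc q(1) by (auto simp: case_prod_beta')
    with K(2)[OF q] show ?thesis by simp
  qed
  moreover have "measure_pmf.expectation (M (Suc t)) (\<lambda>q. gap (Qr (Suc t)) (fst q))
      \<le> D / 4 + \<sigma> (Suc t) * R\<^sup>2"
  proof -
    have "measure_pmf.expectation (M (Suc t)) (\<lambda>q. gap (Qr (Suc t)) (fst q))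
        \<le> measure_pmf.expectation (M (Suc t)) (\<lambda>q. 1 * gap (Qr t) (fst q) + \<sigma> (Suc t) / 2 * R\<^sup>2)"
      by (rule expectation_mono_finite[OF finS]) (use gap_Suc_le in simp)
    also have "\<dots> = measure_pmf.expectation (M (Suc t)) (\<lambda>q. gap (Qr t) (fst q)) + \<sigma> (Suc t) / 2 * R\<^sup>2"
      by (subst expectation_affine_finite[OF finS]) simp
    also have "measure_pmf.expectation (M (Suc t)) (\<lambda>q. gap (Qr t) (fst q))
        = measure_pmf.expectation (M t) (\<lambda>q. measure_pmf.expectation (K q) (\<lambda>q. gap (Qr t) (fst q)))"
      unfolding M by (rule expectation_bind_pmf_finite[OF fin K(1)])
    also have "\<dots> \<le> measure_pmf.expectation (M t) (\<lambda>q. 1 / 4 * gap (Qr t) (fst q) + 0)"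
      by (rule expectation_mono_finite[OF fin]) (use K(3) in simp)
    also have "\<dots> = 1 / 4 * measure_pmf.expectation (M t) (\<lambda>q. gap (Qr t) (fst q)) + 0"
      by (rule expectation_affine_finite[OF fin])
    also have "\<dots> \<le> 1 / 4 * (D + \<sigma> t * R\<^sup>2) + 0" using Suc by (simp add: D_def)
    finally show ?thesis by (simp add: field_simps)
  qed
  ultimately show ?case using finS by (auto simp: D_def)
qed

text \<open>Ensures that the stopping rule is meaningful at every point from which a round can
  start.\<close>

lemma quartered_in_each_round:
  assumes "(z, c) \<in> set_pmf (M t)"
  shows "\<exists>k. quartered (Qr t) (\<sigma> t) (A t) z k"
proof -
  obtain u where "asvrg_strongly_convex (Qr t) (A t) (\<sigma> t) u" using round_analysis by blast
  then interpret r: asvrg_strongly_convex "Qr t" "A t" "\<sigma> t" u .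
  have "z \<in> X" using rounds_analysis[of t] assms by auto
  then show ?thesis using r.quartered_2 by auto
qed

text \<open>Removing the regularizer costs half of \<open>\<sigma> t * R^2\<close>: the regularized
  minimum is at most the regularized value at \<open>xstar\<close>.\<close>

lemma final_gap:
  "measure_pmf.expectation (M t) (\<lambda>(x, _). objective Q x) - objective Q xstar
    \<le> (objective Q x0 - objective Q xstar) / 4 ^ t + 3 / 2 * (\<sigma> t * R\<^sup>2)"
proof -
  obtain u where u: "u \<in> X" "\<And>w. w \<in> X \<Longrightarrow> objective (Qr t) u \<le> objective (Qr t) w"
    "\<And>x. gap (Qr t) x = objective (Qr t) x - objective (Qr t) u"
    using gap_regularized[of t] by metis
  have fin: "finite (set_pmf (M t))" using rounds_analysis by blast
  have "measure_pmf.expectation (M t) (\<lambda>q. objective Q (fst q))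
      \<le> measure_pmf.expectation (M t) (\<lambda>q. 1 * gap (Qr t) (fst q) + (objective Q xstar + \<sigma> t / 2 * R\<^sup>2))"
  proof (rule expectation_mono_finite[OF fin])
    fix q :: "rvec \<times> nat"
    have "0 \<le> \<sigma> t / 2 * (norm (fst q - x0))\<^sup>2" using \<sigma>0 by simp
    then show "objective Q (fst q) \<le> 1 * gap (Qr t) (fst q) + (objective Q xstar + \<sigma> t / 2 * R\<^sup>2)"
      using u(2)[OF xstar] unfolding u(3) objective_regularize norm_minus_commute[of xstar] by simp
  qed
  also have "\<dots> = 1 * measure_pmf.expectation (M t) (\<lambda>q. gap (Qr t) (fst q))
      + (objective Q xstar + \<sigma> t / 2 * R\<^sup>2)"
    by (rule expectation_affine_finite[OF fin])
  finally have "measure_pmf.expectation (M t) (\<lambda>q. objective Q (fst q))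
      \<le> measure_pmf.expectation (M t) (\<lambda>q. gap (Qr t) (fst q)) + (objective Q xstar + \<sigma> t * R\<^sup>2 / 2)" by simp
  moreover have "measure_pmf.expectation (M t) (\<lambda>q. gap (Qr t) (fst q))
      \<le> (objective Q x0 - objective Q xstar) / 4 ^ t + \<sigma> t * R\<^sup>2" using rounds_analysis by blast
  moreover have "a - f \<le> d + 3 / 2 * s" if "a \<le> b + (f + s / 2)" "b \<le> d + s" for a b d f s :: real
    using that by linarith
  ultimately show ?thesis unfolding case_prod_beta' by blast
qed

end


section \<open>The complexity bound\<close>

lemma sum_sqrt2_powers_le: "(\<Sum>i<t. sqrt 2 ^ i) \<le> 3 * sqrt 2 ^ t"
proof (induction t)
  case (Suc t)
  \<comment> \<open>The induction step amounts to \<open>3 + 1 \<le> 3 * sqrt 2\<close>.\<close>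
  have "4 / 3 \<le> sqrt (2 :: real)" by (rule real_le_rsqrt) (simp add: power2_eq_square)
  then have "4 * sqrt 2 ^ t \<le> (3 * sqrt 2) * sqrt (2 :: real) ^ t" by (intro mult_right_mono) auto
  with Suc show ?case unfolding sum.lessThan_Suc power_Suc mult.assoc by linarith
qed simp

theorem corollary8:
  shows "\<exists>C > 0. \<exists>(sigma0 :: real \<Rightarrow> real \<Rightarrow> real \<Rightarrow> real) (rounds :: real \<Rightarrow> real \<Rightarrow> real \<Rightarrow> nat).
    \<forall>(Q :: finite_sum) (x0 :: rvec) (xstar :: rvec) (\<epsilon> :: real).
      finite_sum_problem Q \<and>
      x0 \<in> Rd (vdim Q) \<and> xstar \<in> Rd (vdim Q) \<and>
      (\<forall>x\<in>Rd (vdim Q). objective Q xstar \<le> objective Q x) \<and>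
      0 < \<epsilon> \<and> \<epsilon> \<le> (objective Q x0 - objective Q xstar) / 2
    \<longrightarrow>
      (let \<Delta> = objective Q x0 - objective Q xstar;
           R = norm (x0 - xstar);
           \<sigma>0 = sigma0 \<Delta> R \<epsilon>;
           T = rounds \<Delta> R \<epsilon>
       in 0 < \<sigma>0 \<and>
          (\<exists>A :: nat \<Rightarrow> asvrg_params.
             (\<forall>t<T. admissible_params Q (A t)) \<and>
             (\<forall>t<T. \<forall>(z, c) \<in> set_pmf (adapt_reg_asvrg Q x0 \<sigma>0 A t).
                \<exists>k. quartered (regularize Q x0 (\<sigma>0 / 2 ^ t)) (\<sigma>0 / 2 ^ t) (A t) z k) \<and>
             measure_pmf.expectation (adapt_reg_asvrg Q x0 \<sigma>0 A T) (\<lambda>(x, _). objective Q x)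
               - objective Q xstar \<le> \<epsilon> \<and>
             (\<forall>(x, c) \<in> set_pmf (adapt_reg_asvrg Q x0 \<sigma>0 A T).
                real c \<le> C * (real (size_n Q) * ln (\<Delta> / \<epsilon>)
                  + sqrt (real (size_n Q) * Ltilde Q) * R / sqrt \<epsilon>))))"
proof (rule exI[of _ 540], intro conjI exI allI impI)
  fix Q x0 xstar and \<epsilon> :: real
  assume asm: "finite_sum_problem Q \<and> x0 \<in> Rd (vdim Q) \<and> xstar \<in> Rd (vdim Q) \<and>
      (\<forall>x\<in>Rd (vdim Q). objective Q xstar \<le> objective Q x) \<and>
      0 < \<epsilon> \<and> \<epsilon> \<le> (objective Q x0 - objective Q xstar) / 2"
  define \<Delta> where "\<Delta> = objective Q x0 - objective Q xstar"
  define R where "R = norm (x0 - xstar)"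
  \<comment> \<open>The witnesses: \<open>\<sigma>0\<close> makes \<open>\<sigma>0 * R^2\<close>
    equal to the initial gap, and \<open>T\<close> puts \<open>2 ^ T\<close> between 4 and 8 times
    \<open>\<Delta> / \<epsilon>\<close>.\<close>
  define \<sigma>0 where "\<sigma>0 = \<Delta> / R\<^sup>2"
  define T where "T = nat \<lceil>log 2 (4 * (\<Delta> / \<epsilon>))\<rceil>"
  define A where "A = (\<lambda>t. round_params Q (\<sigma>0 / 2 ^ t))"
  have \<epsilon>: "0 < \<epsilon>" "2 * \<epsilon> \<le> \<Delta>" using asm by (auto simp: \<Delta>_def)
  have \<Delta>: "0 < \<Delta>" using \<epsilon> by linarith
  then have "x0 \<noteq> xstar" by (auto simp: \<Delta>_def)
  then have R: "0 < R" by (simp add: R_def)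
  have \<sigma>0: "0 < \<sigma>0" using \<Delta> R by (simp add: \<sigma>0_def)
  interpret adaptive_regularization Q x0 xstar \<sigma>0
    using asm \<sigma>0 by unfold_locales auto
  define l where "l = log 2 (\<Delta> / \<epsilon>)"
  \<comment> \<open>The smallness of \<open>\<epsilon>\<close> gives \<open>l \<ge> 1\<close>, which
    lets the logarithm absorb the constant number of extra rounds.\<close>
  have ratio: "2 \<le> \<Delta> / \<epsilon>" using \<epsilon> by (simp add: field_simps)
  have l: "1 \<le> l" using ratio by (simp add: l_def le_log_iff)
  have "log 2 (4 :: real) = 2" using log_pow_cancel[of "2 :: real" 2] by simp
  then have log4: "log 2 (4 * (\<Delta> / \<epsilon>)) = 2 + l"
    using log_mult[of 2 4 "\<Delta> / \<epsilon>"] \<epsilon>(1) \<Delta> by (simp add: l_def)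
  have T: "2 + l \<le> real T" "real T \<le> 3 + l" unfolding T_def log4 using l by linarith+
  have pow: "2 powr l = \<Delta> / \<epsilon>" using ratio by (simp add: l_def)
  have "2 powr (2 + l) \<le> 2 powr real T" using T by (intro powr_mono) auto
  then have T_ge: "4 * (\<Delta> / \<epsilon>) \<le> 2 ^ T" by (simp add: powr_add pow powr_realpow powr_numeral)
  have "2 powr real T \<le> 2 powr (3 + l)" using T by (intro powr_mono) auto
  then have T_le: "2 ^ T \<le> 8 * (\<Delta> / \<epsilon>)" by (simp add: powr_add pow powr_realpow powr_numeral)
  have \<sigma>R: "\<sigma>0 / 2 ^ T * R\<^sup>2 = \<Delta> / 2 ^ T" using R by (simp add: \<sigma>0_def)
  have gap_bound: "measure_pmf.expectation (adapt_reg_asvrg Q x0 \<sigma>0 A T) (\<lambda>(x, _). objective Q x)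
      - objective Q xstar \<le> \<epsilon>"
  proof -
    \<comment> \<open>Both error terms are measured by \<open>\<Delta> / 2 ^ T\<close>, at most
      \<open>\<epsilon> / 4\<close>; together they give at most
      \<open>5/2 * \<epsilon> / 4\<close>.\<close>
    have "\<Delta> / 4 ^ T \<le> \<Delta> / 2 ^ T" using \<Delta> by (intro divide_left_mono power_mono) auto
    moreover have "\<Delta> / 2 ^ T \<le> \<epsilon> / 4" using T_ge \<epsilon> by (simp add: field_simps)
    ultimately show ?thesis
      using final_gap[of T] \<epsilon>(1) unfolding \<Delta>_def[symmetric] R_def[symmetric] \<sigma>R A_def by linarith
  qed
  have cost_bound: "real c \<le> 540 * (real n * ln (\<Delta> / \<epsilon>) + sqrt (real n * \<Lambda>) * R / sqrt \<epsilon>)"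
    if "(x, c) \<in> set_pmf (adapt_reg_asvrg Q x0 \<sigma>0 A T)" for x c
  proof -
    define b where "b = sqrt (real n * \<Lambda>) * R / sqrt \<Delta>"
    have b: "0 \<le> b" using \<Delta> R Ltilde_pos by (simp add: b_def)
    \<comment> \<open>Halving \<open>\<sigma>\<close> multiplies the accelerated part of the cost by
      \<open>sqrt 2\<close>, so these parts form a geometric series.\<close>
    have "sqrt (real n * \<Lambda> / \<sigma> i) = b * sqrt 2 ^ i" for i
    proof -
      have "real n * \<Lambda> / \<sigma> i = real n * \<Lambda> * R\<^sup>2 / \<Delta> * 2 ^ i" using R \<Delta> by (simp add: \<sigma>0_def)
      then show ?thesis using R by (simp add: b_def real_sqrt_mult real_sqrt_divide real_sqrt_power)
    qed
    then have "(\<Sum>i<T. cost i) = 18 * real n * real T + 60 * (b * (\<Sum>i<T. sqrt 2 ^ i))"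
      by (simp add: sum.distrib sum_distrib_left)
    moreover have "real c \<le> (\<Sum>i<T. cost i)"
      using rounds_analysis[of T] that by (auto simp: A_def)
    moreover have "18 * real n * real T \<le> 540 * (real n * ln (\<Delta> / \<epsilon>))"
    proof -
      have "real T \<le> 4 * l" using T l by linarith
      \<comment> \<open>Change of base, with \<open>ln 2 \<ge> 1/2\<close>.\<close>
      moreover have "l \<le> 2 * ln (\<Delta> / \<epsilon>)"
      proof -
        have "0 \<le> ln (\<Delta> / \<epsilon>)" using ratio by simp
        then have "1 / 2 * ln (\<Delta> / \<epsilon>) * (1 / ln 2) \<le> ln 2 * ln (\<Delta> / \<epsilon>) * (1 / ln 2)"
          using ln2_ge_two_thirds by (intro mult_right_mono) auto
        then show ?thesis by (simp add: l_def log_def)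
      qed
      ultimately have "real T \<le> 30 * ln (\<Delta> / \<epsilon>)" using l by linarith
      then have "18 * real n * real T \<le> 18 * real n * (30 * ln (\<Delta> / \<epsilon>))" by (intro mult_left_mono) auto
      then show ?thesis by simp
    qed
    moreover have "b * (\<Sum>i<T. sqrt 2 ^ i) \<le> 9 * (sqrt (real n * \<Lambda>) * R / sqrt \<epsilon>)"
    proof -
      have "sqrt 2 ^ T = sqrt (2 ^ T)" by (simp add: real_sqrt_power)
      \<comment> \<open>The 8 is rounded up to 9 to have an exact root; with the factor 3 of the
        series this gives 9.\<close>
      also have "\<dots> \<le> sqrt (9 * (\<Delta> / \<epsilon>))" using T_le ratio by (intro real_sqrt_le_mono) linarith
      also have "\<dots> = 3 * (sqrt \<Delta> / sqrt \<epsilon>)" by (simp add: real_sqrt_mult real_sqrt_divide)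
      finally have "(\<Sum>i<T. sqrt 2 ^ i) \<le> 9 * (sqrt \<Delta> / sqrt \<epsilon>)" using sum_sqrt2_powers_le[of T] by linarith
      then have "b * (\<Sum>i<T. sqrt 2 ^ i) \<le> b * (9 * (sqrt \<Delta> / sqrt \<epsilon>))" using b by (rule mult_left_mono)
      then show ?thesis using \<Delta> by (simp add: b_def mult_ac)
    qed
    \<comment> \<open>The constant fits both parts: \<open>540 = 18 * 30\<close> for the logarithmic
      term and \<open>540 = 60 * 9\<close> for the square root term.\<close>
    moreover have "r \<le> 540 * (h + w)" if "r \<le> s" "s = a + 60 * d" "a \<le> 540 * h" "d \<le> 9 * w"
      for r s a d h w :: real using that by (simp add: distrib_left)
    ultimately show ?thesis by blast
  qed
  have "\<forall>t<T. admissible_params Q (A t)"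
    using round_params_admissible \<sigma>_pos by (simp add: A_def)
  moreover have "\<forall>t<T. \<forall>(z, c) \<in> set_pmf (adapt_reg_asvrg Q x0 \<sigma>0 A t).
      \<exists>k. quartered (regularize Q x0 (\<sigma>0 / 2 ^ t)) (\<sigma>0 / 2 ^ t) (A t) z k"
    using quartered_in_each_round by (auto simp: A_def)
  ultimately show "let \<Delta> = objective Q x0 - objective Q xstar;
           R = norm (x0 - xstar);
           \<sigma>0 = (\<lambda>\<Delta> R \<epsilon>. \<Delta> / R\<^sup>2) \<Delta> R \<epsilon>;
           T = (\<lambda>\<Delta> R \<epsilon>. nat \<lceil>log 2 (4 * (\<Delta> / \<epsilon>))\<rceil>) \<Delta> R \<epsilon>
       in 0 < \<sigma>0 \<and>
          (\<exists>A :: nat \<Rightarrow> asvrg_params.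
             (\<forall>t<T. admissible_params Q (A t)) \<and>
             (\<forall>t<T. \<forall>(z, c) \<in> set_pmf (adapt_reg_asvrg Q x0 \<sigma>0 A t).
                \<exists>k. quartered (regularize Q x0 (\<sigma>0 / 2 ^ t)) (\<sigma>0 / 2 ^ t) (A t) z k) \<and>
             measure_pmf.expectation (adapt_reg_asvrg Q x0 \<sigma>0 A T) (\<lambda>(x, _). objective Q x)
               - objective Q xstar \<le> \<epsilon> \<and>
             (\<forall>(x, c) \<in> set_pmf (adapt_reg_asvrg Q x0 \<sigma>0 A T).
                real c \<le> 540 * (real (size_n Q) * ln (\<Delta> / \<epsilon>)
                  + sqrt (real (size_n Q) * Ltilde Q) * R / sqrt \<epsilon>)))"
    unfolding Let_def \<Delta>_def[symmetric] R_def[symmetric] \<sigma>0_def[symmetric] T_def[symmetric]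
    using \<sigma>0 gap_bound cost_bound by blast
qed simp

end
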